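(* Let $f\in\mathbb{C}[x]$ be a polynomial of degree $d\ge 2$, let $g\in\mathbb{C}[x]$ be a nonconstant polynomial, and let $c\in\mathbb{C}^*$. Then there exist at most finitely many $\lambda\in\mathbb{C}$ such that both $g(\lambda)$ and $g(\lambda+c)$ are preperiodic for $f$.
   Context: For a polynomial $f$, $f^n$ denotes the $n$-th iterate under composition. A point $x\in\mathbb{C}$ is preperiodic for $f$ if $f^i(x)=f^j(x)$ for some distinct nonnegative integers $i,j$. *)

theory Defs
  imports Complex_Main "HOL-Computational_Algebra.Polynomial"
begin

definition preperiodic :: "complex poly \<Rightarrow> complex \<Rightarrow> bool" where
  "preperiodic f x \<longleftrightarrow> (\<exists>i j. i \<noteq> j \<and> (poly f ^^ i) x = (poly f ^^ j) x)"

end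

theory Submission
  imports Defs "Jordan_Normal_Form.Char_Poly"
    "HOL-Computational_Algebra.Fundamental_Theorem_Algebra" "HOL-Library.Countable_Set"
    "HOL-Analysis.Continuum_Not_Denumerable" "HOL-Real_Asymp.Real_Asymp"
begin

text \<open>
The proof follows the idea of Fekete's theorem that only finitely many algebraic integers have all
their conjugates in a given compact set of capacity less than 1. Call \<open>z\<close> a common point if
both \<open>g(z)\<close> and \<open>g(z + c)\<close> are preperiodic for \<open>f\<close>. Linear changes of coordinates make \<open>f\<close> and \<open>g\<close> monic. Then the
polynomials \<open>F\<^sub>n = f\<^sup>n \<circ> g\<close> are monic, of degree \<open>m\<^sub>n\<close> tending to infinity, and both \<open>F\<^sub>n(z)\<close> and \<open>F\<^sub>n(z + c)\<close> are bounded by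
a constant \<open>R\<close> independent of \<open>n\<close> and of the common point, since they lie on finite orbits.

Common points lie in a set of capacity less than 1, for a very simple reason: the
difference \<open>F\<^sub>n(X + c) - F\<^sub>n(X)\<close> has degree \<open>m\<^sub>n - 1\<close> and leading coefficient \<open>m\<^sub>n c\<close>, so dividing by it gives a monic
polynomial \<open>H\<close> of modulus at most \<open>2 R / (m\<^sub>n |c|)\<close> at all common points, and this is at most 1/2 for suitable \<open>n\<close>. The
Vandermonde determinant \<open>V\<close> of \<open>N\<close> distinct common points can be computed with any monic polynomials of degrees
\<open>0, ..., N - 1\<close> in place of the powers. With products of powers of \<open>H\<close> and of \<open>X\<close> one finds that \<open>|V|\<close> is at most
\<open>exp(- \<delta> N\<^sup>2)\<close> for some \<open>\<delta> > 0\<close> and large \<open>N\<close> (lemma \<open>power_det_small\<close>).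

Arithmetic gives the opposite bound. If \<open>p\<close> is a common denominator of the coefficients, then \<open>p\<close> times any
preperiodic point is integral, however long its orbit (lemma \<open>preperiodic_integral\<close>). Computing \<open>V\<close>
with powers of \<open>F\<^sub>k\<close> for \<open>k\<close> much larger than \<open>n\<close> shows that \<open>p\<^sup>W V\<close> is integral for some \<open>W\<close> of
size about \<open>N\<^sup>2 / m\<^sub>k\<close>, which is negligible against \<open>\<delta> N\<^sup>2\<close>. A conjugate of a common point is a common point for the conjugate
data, so all conjugates of \<open>p\<^sup>W V\<close> are small. For algebraic data this contradicts \<open>V \<noteq> 0\<close>, since a nonzero algebraic
integer has a conjugate of modulus at least 1.

For arbitrary complex data the conjugates are replaced by field homomorphisms into the complex numbers under
which \<open>p\<close>, the coefficients of \<open>f\<close> and \<open>g\<close>, and both \<open>c\<close> and \<open>1/c\<close> stay bounded by one constant. The property \<open>controlled\<close>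
expresses that sufficiently many such homomorphisms exist, and lemma \<open>exists_controllable\<close> constructs fields
with this property by adjoining the data one at a time. Algebraic elements are treated by the norm, and
transcendental ones by specialization to multiples of roots of unity followed by a small perturbation. The \<open>N\<close> common
points are adjoined last and do not affect the constants, so \<open>N\<close> can be chosen after all other parameters.
\<close>

section \<open>Subrings and integral closure\<close>

definition is_subring :: "'a :: comm_ring_1 set \<Rightarrow> bool" where
  "is_subring B \<longleftrightarrow> 1 \<in> B \<and> (\<forall>x\<in>B. \<forall>y\<in>B. x - y \<in> B \<and> x * y \<in> B)"

lemma
  assumes "is_subring B"
  shows subring_1: "1 \<in> B" and subring_0: "0 \<in> B"
    and subring_diff: "x \<in> B \<Longrightarrow> y \<in> B \<Longrightarrow> x - y \<in> B"
    and subring_mult: "x \<in> B \<Longrightarrow> y \<in> B \<Longrightarrow> x * y \<in> B"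
    and subring_uminus: "x \<in> B \<Longrightarrow> - x \<in> B"
    and subring_add: "x \<in> B \<Longrightarrow> y \<in> B \<Longrightarrow> x + y \<in> B"
proof -
  show 1: "1 \<in> B" and d: "x \<in> B \<Longrightarrow> y \<in> B \<Longrightarrow> x - y \<in> B"
    and "x \<in> B \<Longrightarrow> y \<in> B \<Longrightarrow> x * y \<in> B" for x y
    using assms by (auto simp: is_subring_def)
  from d[OF 1 1] show 0: "0 \<in> B" by simp
  from d[OF 0] show u: "x \<in> B \<Longrightarrow> - x \<in> B" for x by simp
  from d[OF _ u] show "x \<in> B \<Longrightarrow> y \<in> B \<Longrightarrow> x + y \<in> B" by fastforce
qed

lemma subring_power: "is_subring B \<Longrightarrow> x \<in> B \<Longrightarrow> x ^ n \<in> B"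
  by (induction n) (auto intro: subring_1 subring_mult)

lemma subring_sum: "is_subring B \<Longrightarrow> (\<And>i. i \<in> I \<Longrightarrow> h i \<in> B) \<Longrightarrow> sum h I \<in> B"
  by (induction I rule: infinite_finite_induct) (auto intro: subring_0 subring_add)

lemma subring_prod: "is_subring B \<Longrightarrow> (\<And>i. i \<in> I \<Longrightarrow> h i \<in> B) \<Longrightarrow> prod h I \<in> B"
  by (induction I rule: infinite_finite_induct) (auto intro: subring_1 subring_mult)

lemma subring_of_nat: "is_subring B \<Longrightarrow> of_nat n \<in> B"
  by (induction n) (auto intro: subring_0 subring_1 subring_add)

lemmas subring_intros = subring_0 subring_1 subring_add subring_diff subring_mult
  subring_uminus subring_power subring_sum subring_prod subring_of_nat

text \<open>Subrings and subfields are handled as sets of numbers and not as types, so that the polynomials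
over all of them share one type and can be evaluated at arbitrary elements.\<close>

definition polys :: "'a :: comm_ring_1 set \<Rightarrow> 'a poly set" where
  "polys B = {P. \<forall>i. coeff P i \<in> B}"

lemma polysD: "P \<in> polys B \<Longrightarrow> coeff P i \<in> B"
  by (simp add: polys_def)

lemma finite_range_coeff: "finite (range (coeff (P :: 'a :: zero poly)))"
proof (rule finite_subset)
  show "range (coeff P) \<subseteq> insert 0 (coeff P ` {..degree P})"
    by (auto simp: image_iff) (metis atMost_iff coeff_eq_0 not_le)
qed auto

lemma polys_mono: "B \<subseteq> C \<Longrightarrow> polys B \<subseteq> polys C"
  by (auto simp: polys_def)

lemma subring_polys: "is_subring B \<Longrightarrow> is_subring (polys B)"
  unfolding is_subring_def[of "polys B"]
  by (auto simp: polys_def coeff_mult intro!: subring_intros)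

lemma pCons_polys: "is_subring B \<Longrightarrow> a \<in> B \<Longrightarrow> P \<in> polys B \<Longrightarrow> pCons a P \<in> polys B"
  by (auto simp: polys_def coeff_pCons split: nat.splits)

lemma monom_polys: "is_subring B \<Longrightarrow> a \<in> B \<Longrightarrow> monom a n \<in> polys B"
  by (auto simp: polys_def intro: subring_0)

lemma smult_polys: "is_subring B \<Longrightarrow> a \<in> B \<Longrightarrow> P \<in> polys B \<Longrightarrow> Polynomial.smult a P \<in> polys B"
  by (auto simp: polys_def intro: subring_mult)

lemma poly_polys: "is_subring B \<Longrightarrow> P \<in> polys B \<Longrightarrow> x \<in> B \<Longrightarrow> poly P x \<in> B"
  by (auto simp: poly_altdef polys_def intro!: subring_intros)

text \<open>The integral closure of \<open>B\<close> in the ambient field. When \<open>B\<close> is a subfield this is the set of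
elements algebraic over it.\<close>

definition icl :: "'a :: field set \<Rightarrow> 'a set" where
  "icl B = {x. \<exists>P\<in>polys B. lead_coeff P = 1 \<and> poly P x = 0}"

definition span_over :: "'a :: comm_ring_1 set \<Rightarrow> 'a set \<Rightarrow> 'a set" where
  "span_over B S = {\<Sum>s\<in>S. b s * s | b. \<forall>s\<in>S. b s \<in> B}"

text \<open>The multipliers of the \<open>B\<close>-module spanned by \<open>S\<close>. They form a ring, so closure properties
of integral elements come for free once integrality is read as membership in such a stabilizer for a
finite set \<open>S\<close> containing 1.\<close>

definition stabilizer :: "'a :: comm_ring_1 set \<Rightarrow> 'a set \<Rightarrow> 'a set" where
  "stabilizer B S = {x. \<forall>s\<in>S. x * s \<in> span_over B S}"

context
  fixes B :: "'a :: comm_ring_1 set"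
  assumes B: "is_subring B"
begin

lemma span_over_0: "0 \<in> span_over B S"
  unfolding span_over_def by (rule CollectI, rule exI[of _ "\<lambda>_. 0"]) (auto intro: subring_0 B)

lemma span_over_diff: "x \<in> span_over B S \<Longrightarrow> y \<in> span_over B S \<Longrightarrow> x - y \<in> span_over B S"
proof -
  assume "x \<in> span_over B S" "y \<in> span_over B S"
  then obtain a b where "\<forall>s\<in>S. a s \<in> B" "\<forall>s\<in>S. b s \<in> B"
    "x = (\<Sum>s\<in>S. a s * s)" "y = (\<Sum>s\<in>S. b s * s)" by (auto simp: span_over_def)
  then show ?thesis unfolding span_over_def
    by (intro CollectI exI[of _ "\<lambda>s. a s - b s"])
      (auto simp: sum_subtractf algebra_simps intro: subring_diff B)
qed

lemma span_over_uminus: "x \<in> span_over B S \<Longrightarrow> - x \<in> span_over B S"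
  using span_over_diff[OF span_over_0] by fastforce

lemma span_over_add: "x \<in> span_over B S \<Longrightarrow> y \<in> span_over B S \<Longrightarrow> x + y \<in> span_over B S"
  using span_over_diff[OF _ span_over_uminus] by fastforce

lemma span_over_sum: "(\<And>i. i \<in> I \<Longrightarrow> h i \<in> span_over B S) \<Longrightarrow> sum h I \<in> span_over B S"
  by (induction I rule: infinite_finite_induct) (auto intro: span_over_0 span_over_add)

lemma span_over_scale: "c \<in> B \<Longrightarrow> x \<in> span_over B S \<Longrightarrow> c * x \<in> span_over B S"
proof -
  assume c: "c \<in> B" and "x \<in> span_over B S"
  then obtain a where "\<forall>s\<in>S. a s \<in> B" "x = (\<Sum>s\<in>S. a s * s)" by (auto simp: span_over_def)
  then show ?thesis unfolding span_over_def using c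
    by (intro CollectI exI[of _ "\<lambda>s. c * a s"])
      (auto simp: sum_distrib_left algebra_simps intro: subring_mult B)
qed

lemma span_over_base: "finite S \<Longrightarrow> s \<in> S \<Longrightarrow> s \<in> span_over B S"
  unfolding span_over_def
  by (intro CollectI exI[of _ "\<lambda>t. if t = s then 1 else 0"])
    (auto intro: subring_0 subring_1 B simp: if_distrib[of "\<lambda>z. z * _"] cong: if_cong)

lemma span_over_mult:
  assumes "x \<in> stabilizer B S" "y \<in> span_over B S"
  shows "x * y \<in> span_over B S"
proof -
  obtain b where b: "\<forall>s\<in>S. b s \<in> B" "y = (\<Sum>s\<in>S. b s * s)"
    using assms(2) by (auto simp: span_over_def)
  have "x * y = (\<Sum>s\<in>S. b s * (x * s))"
    by (simp add: b sum_distrib_left algebra_simps)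
  also have "\<dots> \<in> span_over B S"
    using assms(1) b by (intro span_over_sum span_over_scale[of "b _"]) (auto simp: stabilizer_def)
  finally show ?thesis .
qed

lemma subring_stabilizer: "finite S \<Longrightarrow> is_subring (stabilizer B S)"
  unfolding is_subring_def
proof (intro conjI ballI)
  assume S: "finite S"
  show "1 \<in> stabilizer B S" using span_over_base[OF S] by (simp add: stabilizer_def)
  fix x y assume x: "x \<in> stabilizer B S" and y: "y \<in> stabilizer B S"
  show "x - y \<in> stabilizer B S"
    using x y by (auto simp: stabilizer_def left_diff_distrib intro: span_over_diff)
  show "x * y \<in> stabilizer B S" 
    using y span_over_mult[OF x] by (auto simp: stabilizer_def mult.assoc)
qed

lemma stabilizer_base: "finite S \<Longrightarrow> B \<subseteq> stabilizer B S"
  by (auto simp: stabilizer_def intro: span_over_scale span_over_base)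

text \<open>If \<open>y\<close> is a root of a monic polynomial of degree \<open>n\<close> over the stabilizer, then enlarging
the spanning set to the products of its elements with \<open>1, y, ..., y\<^sup>n\<^sup>-\<^sup>1\<close> keeps everything stable,
because the equation rewrites \<open>s * y\<^sup>n\<close> in lower powers.\<close>

lemma stabilizer_adjoin:
  assumes S: "finite S" "1 \<in> S" and P: "P \<in> polys (stabilizer B S)" "lead_coeff P = 1" "poly P y = 0"
  shows "\<exists>S'. finite S' \<and> 1 \<in> S' \<and> insert y (stabilizer B S) \<subseteq> stabilizer B S'"
proof -
  define n where "n = degree P"
  define S' where "S' = (\<lambda>(s, i). s * y ^ i) ` (S \<times> {..<n})"
  have "n \<noteq> 0"
  proof
    assume "n = 0"
    then obtain a where "P = [:a:]" using degree_eq_zeroE unfolding n_def by blast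
    with P(2,3) show False by simp
  qed
  have fin: "finite S'" using S by (simp add: S'_def)
  have "1 * y ^ 0 \<in> S'" unfolding S'_def using \<open>n \<noteq> 0\<close> S
    by (intro image_eqI[of _ _ "(1, 0)"]) auto
  then have one: "1 \<in> S'" by simp
  have lift: "x * y ^ i \<in> span_over B S'" if "x \<in> span_over B S" "i < n" for x i
  proof -
    obtain b where b: "\<forall>s\<in>S. b s \<in> B" "x = (\<Sum>s\<in>S. b s * s)"
      using \<open>x \<in> span_over B S\<close> by (auto simp: span_over_def)
    have "x * y ^ i = (\<Sum>s\<in>S. b s * (s * y ^ i))"
      unfolding b(2) sum_distrib_right by (simp only: mult.assoc)
    also have "\<dots> \<in> span_over B S'" using b \<open>i < n\<close>
      by (intro span_over_sum span_over_scale span_over_base fin) (auto simp: S'_def)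
    finally show ?thesis .
  qed
  have "x \<in> stabilizer B S'" if x: "x \<in> stabilizer B S" for x
    unfolding stabilizer_def
  proof (intro CollectI ballI)
    fix t assume "t \<in> S'"
    then obtain s i where si: "s \<in> S" "i < n" "t = s * y ^ i" by (auto simp: S'_def)
    have "x * s * y ^ i \<in> span_over B S'" using x si by (intro lift) (auto simp: stabilizer_def)
    then show "x * t \<in> span_over B S'" by (simp add: si mult.assoc)
  qed
  moreover have "y \<in> stabilizer B S'" 
    unfolding stabilizer_def
  proof (intro CollectI ballI)
    fix t assume "t \<in> S'"
    then obtain s i where si: "s \<in> S" "i < n" "t = s * y ^ i" by (auto simp: S'_def)
    show "y * t \<in> span_over B S'"
    proof (cases "Suc i = n")
      case False
      then have "s * y ^ Suc i \<in> span_over B S'" using si 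
        by (intro lift span_over_base S) auto
      then show ?thesis by (simp add: si algebra_simps)
    next
      case True
      have "0 = (\<Sum>j\<le>n. coeff P j * y ^ j)" using P(3) by (simp add: poly_altdef n_def)
      also have "\<dots> = (\<Sum>j<n. coeff P j * y ^ j) + y ^ n"
        using P(2) by (simp add: n_def lessThan_Suc_atMost[symmetric])
      finally have yn: "y ^ n = - (\<Sum>j<n. coeff P j * y ^ j)" 
        by (metis add.commute add_eq_0_iff)
      have "y * t = s * y ^ n" by (simp add: si True[symmetric] algebra_simps)
      also have "\<dots> = - (\<Sum>j<n. coeff P j * s * y ^ j)"
        by (simp add: yn sum_distrib_left algebra_simps)
      also have "\<dots> \<in> span_over B S'" using P(1) si
        by (intro span_over_uminus span_over_sum lift) (auto simp: polys_def stabilizer_def)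
      finally show ?thesis .
    qed
  qed
  ultimately show ?thesis using fin one by blast
qed

end

lemma char_poly_polys:
  assumes B: "is_subring B" and A: "A \<in> carrier_mat n n"
    and AB: "\<And>i j. i < n \<Longrightarrow> j < n \<Longrightarrow> A $$ (i, j) \<in> B"
  shows "char_poly A \<in> polys B"
proof -
  have 1: "char_poly_matrix A \<in> carrier_mat n n" using A by simp
  have "char_poly_matrix A $$ (i, j) \<in> polys B" if "i < n" "j < n" for i j
    using A AB[OF that] that B
    by (auto simp: char_poly_matrix_def intro!: pCons_polys subring_intros subring_polys[OF B])
  then show ?thesis unfolding char_poly_def det_def'[OF 1]
    by (intro subring_sum subring_mult subring_prod subring_polys B)
      (auto simp: sign_def permutes_in_image intro!: subring_1 subring_uminus subring_polys B)
qed

text \<open>Multiplication by an element of the stabilizer acts on the spanning set by a matrix over \<open>B\<close>,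
and the vector of spanning elements is an eigenvector of this matrix. The characteristic polynomial is
then the required monic equation.\<close>

lemma stabilizer_subset_icl:
  fixes B :: "'a :: field set"
  assumes B: "is_subring B" and S: "finite S" "1 \<in> S"
  shows "stabilizer B S \<subseteq> icl B"
proof
  fix x assume x: "x \<in> stabilizer B S"
  obtain n and m :: "nat \<Rightarrow> 'a" where m: "S = m ` {0..<n}" "inj_on m {0..<n}"
    using S(1) finite_imp_nat_seg_image_inj_on by (metis atLeast0LessThan lessThan_def)
  have "\<exists>b. (\<forall>s\<in>S. b s \<in> B) \<and> x * m i = (\<Sum>s\<in>S. b s * s)" if "i < n" for i
    using x m(1) that by (force simp: stabilizer_def span_over_def)
  then obtain b where b: "\<And>i s. i < n \<Longrightarrow> s \<in> S \<Longrightarrow> b i s \<in> B"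
    "\<And>i. i < n \<Longrightarrow> x * m i = (\<Sum>s\<in>S. b i s * s)" by metis
  define A where "A = mat n n (\<lambda>(i, j). b i (m j))"
  define v where "v = vec n m"
  have A: "A \<in> carrier_mat n n" by (simp add: A_def)
  have "A *\<^sub>v v = x \<cdot>\<^sub>v v"
  proof (rule eq_vecI)
    fix i assume "i < dim_vec (x \<cdot>\<^sub>v v)"
    then have i: "i < n" by (simp add: v_def)
    have "(A *\<^sub>v v) $ i = (\<Sum>j = 0..<n. b i (m j) * m j)"
      using i by (simp add: A_def v_def scalar_prod_def)
    also have "\<dots> = x * m i" by (simp add: b(2)[OF i] m sum.reindex)
    finally show "(A *\<^sub>v v) $ i = (x \<cdot>\<^sub>v v) $ i" using i by (simp add: v_def)
  qed (simp add: A_def v_def)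
  moreover have "v \<noteq> 0\<^sub>v n"
  proof
    assume "v = 0\<^sub>v n"
    then have "m i = 0" if "i < n" for i using that by (metis v_def index_vec index_zero_vec(1))
    then show False using S(2) m(1) by auto
  qed
  ultimately have "eigenvalue A x" unfolding eigenvalue_def eigenvector_def 
    using A by (intro exI[of _ v]) (auto simp: v_def)
  then have "poly (char_poly A) x = 0" using eigenvalue_root_char_poly[OF A] by simp
  moreover have "char_poly A \<in> polys B"
    by (rule char_poly_polys[OF B A]) (auto simp: A_def m b)
  ultimately show "x \<in> icl B" using degree_monic_char_poly[OF A] by (auto simp: icl_def)
qed

lemma icl_finite_stabilizer:
  fixes B :: "'a :: field set"
  assumes B: "is_subring B" and X: "finite X" "X \<subseteq> icl B"
  shows "\<exists>S. finite S \<and> 1 \<in> S \<and> X \<subseteq> stabilizer B S"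
  using X
proof (induction X)
  case empty
  show ?case by (rule exI[of _ "{1}"]) auto
next
  case (insert x X)
  then obtain S where S: "finite S" "1 \<in> S" "X \<subseteq> stabilizer B S" by auto
  obtain P where P: "P \<in> polys B" "lead_coeff P = 1" "poly P x = 0"
    using insert.prems by (auto simp: icl_def)
  have "P \<in> polys (stabilizer B S)"
    using P(1) polys_mono[OF stabilizer_base[OF B S(1)]] by blast
  from stabilizer_adjoin[OF B S(1,2) this P(2,3)] show ?case using S(3) by blast
qed

text \<open>Two integral elements lie in a common finite stabilizer, which is a ring of integral elements.\<close>

lemma subring_icl:
  fixes B :: "'a :: field set"
  assumes B: "is_subring B"
  shows "is_subring (icl B)"
proof -
  have "1 \<in> icl B" unfolding icl_def
    by (intro CollectI bexI[of _ "[:-1, 1:]"]) (auto intro!: pCons_polys subring_intros B subring_polys)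
  moreover have "x - y \<in> icl B \<and> x * y \<in> icl B" if xy: "x \<in> icl B" "y \<in> icl B" for x y
  proof -
    obtain S where S: "finite S" "1 \<in> S" "{x, y} \<subseteq> stabilizer B S"
      using icl_finite_stabilizer[OF B, of "{x, y}"] xy by (meson empty_subsetI finite.intros insert_subset)
    then show ?thesis 
      using stabilizer_subset_icl[OF B S(1,2)] subring_stabilizer[OF B S(1)]
      by (auto simp: is_subring_def)
  qed
  ultimately show ?thesis by (auto simp: is_subring_def)
qed

lemma icl_mono: "B \<subseteq> C \<Longrightarrow> icl B \<subseteq> icl C"
  using polys_mono[of B C] by (force simp: icl_def)

lemma icl_base: "is_subring B \<Longrightarrow> B \<subseteq> icl B"
proof
  fix x assume "is_subring B" "x \<in> B"
  then show "x \<in> icl B" unfolding icl_def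
    by (intro CollectI bexI[of _ "[:-x, 1:]"]) (auto intro!: pCons_polys subring_intros subring_polys)
qed

text \<open>Transitivity of integrality: the coefficients of an equation over the integral closure lie in one
stabilizer, and a root of the equation is adjoined to it.\<close>

lemma icl_icl:
  fixes B :: "'a :: field set"
  assumes B: "is_subring B"
  shows "icl (icl B) = icl B"
proof
  show "icl B \<subseteq> icl (icl B)" by (intro icl_base subring_icl B)
  show "icl (icl B) \<subseteq> icl B"
  proof
    fix y assume "y \<in> icl (icl B)"
    then obtain P where P: "P \<in> polys (icl B)" "lead_coeff P = 1" "poly P y = 0" 
      by (auto simp: icl_def)
    have "finite (range (coeff P))" by (rule finite_range_coeff)
    then obtain S where S: "finite S" "1 \<in> S" "range (coeff P) \<subseteq> stabilizer B S"
      using icl_finite_stabilizer[OF B, of "range (coeff P)"] P(1) by (auto simp: polys_def) 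
    then have "P \<in> polys (stabilizer B S)" by (auto simp: polys_def)
    from stabilizer_adjoin[OF B S(1,2) this P(2,3)] 
    obtain S' where "finite S'" "1 \<in> S'" "y \<in> stabilizer B S'" by blast
    then show "y \<in> icl B" using stabilizer_subset_icl[OF B] by blast
  qed
qed

lemma icl_root:
  fixes B :: "'a :: field set"
  assumes "is_subring B" "P \<in> polys (icl B)" "lead_coeff P = 1" "poly P y = 0"
  shows "y \<in> icl B"
  using assms icl_icl[OF assms(1)] by (auto simp: icl_def)

section \<open>Homomorphisms of subfields and simple extensions\<close>

definition is_subfield :: "'a :: field set \<Rightarrow> bool" where
  "is_subfield K \<longleftrightarrow> is_subring K \<and> (\<forall>x\<in>K. inverse x \<in> K)"

lemma subfield_subring: "is_subfield K \<Longrightarrow> is_subring K"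
  by (simp add: is_subfield_def)

lemma subfield_inverse: "is_subfield K \<Longrightarrow> x \<in> K \<Longrightarrow> inverse x \<in> K"
  by (simp add: is_subfield_def)

lemma subfield_divide: "is_subfield K \<Longrightarrow> x \<in> K \<Longrightarrow> y \<in> K \<Longrightarrow> x / y \<in> K"
  by (simp add: is_subfield_def divide_inverse subring_mult)

text \<open>Homomorphisms are total functions of which only the values on \<open>K\<close> matter; this allows one and
the same function to be restricted to subfields.\<close>

definition hom_on :: "complex set \<Rightarrow> (complex \<Rightarrow> complex) \<Rightarrow> bool" where
  "hom_on K \<sigma> \<longleftrightarrow> \<sigma> 1 = 1 \<and> (\<forall>x\<in>K. \<forall>y\<in>K. \<sigma> (x - y) = \<sigma> x - \<sigma> y \<and> \<sigma> (x * y) = \<sigma> x * \<sigma> y)"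

context
  fixes K :: "complex set" and \<sigma> :: "complex \<Rightarrow> complex"
  assumes K: "is_subring K" and \<sigma>: "hom_on K \<sigma>"
begin

lemma hom_1: "\<sigma> 1 = 1"
  and hom_diff: "x \<in> K \<Longrightarrow> y \<in> K \<Longrightarrow> \<sigma> (x - y) = \<sigma> x - \<sigma> y"
  and hom_mult: "x \<in> K \<Longrightarrow> y \<in> K \<Longrightarrow> \<sigma> (x * y) = \<sigma> x * \<sigma> y"
  using \<sigma> by (auto simp: hom_on_def)

lemma hom_0: "\<sigma> 0 = 0"
  using hom_diff[of 1 1] subring_1[OF K] by simp

lemma hom_uminus: "x \<in> K \<Longrightarrow> \<sigma> (- x) = - \<sigma> x"
  using hom_diff[of 0 x] subring_0[OF K] hom_0 by simp

lemma hom_add: "x \<in> K \<Longrightarrow> y \<in> K \<Longrightarrow> \<sigma> (x + y) = \<sigma> x + \<sigma> y"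
  using hom_diff[of x "- y"] subring_uminus[OF K] hom_uminus by simp

lemma hom_power: "x \<in> K \<Longrightarrow> \<sigma> (x ^ n) = \<sigma> x ^ n"
  by (induction n) (auto simp: hom_1 hom_mult subring_power K)

lemma hom_sum: "(\<And>i. i \<in> I \<Longrightarrow> h i \<in> K) \<Longrightarrow> \<sigma> (sum h I) = (\<Sum>i\<in>I. \<sigma> (h i))"
  by (induction I rule: infinite_finite_induct) (auto simp: hom_0 hom_add subring_sum K)

lemma hom_prod: "(\<And>i. i \<in> I \<Longrightarrow> h i \<in> K) \<Longrightarrow> \<sigma> (prod h I) = (\<Prod>i\<in>I. \<sigma> (h i))"
  by (induction I rule: infinite_finite_induct) (auto simp: hom_1 hom_mult subring_prod K)

lemma coeff_hom: "coeff (map_poly \<sigma> P) i = \<sigma> (coeff P i)"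
  by (rule coeff_map_poly) (rule hom_0)

lemma map_poly_hom_pCons: "map_poly \<sigma> (pCons a P) = pCons (\<sigma> a) (map_poly \<sigma> P)"
  by (rule poly_eqI) (simp add: coeff_hom coeff_pCons split: nat.split)

lemma map_poly_hom_diff:
  "P \<in> polys K \<Longrightarrow> Q \<in> polys K \<Longrightarrow> map_poly \<sigma> (P - Q) = map_poly \<sigma> P - map_poly \<sigma> Q"
  by (rule poly_eqI) (simp add: coeff_hom hom_diff polysD)

lemma map_poly_hom_mult:
  assumes "P \<in> polys K" "Q \<in> polys K"
  shows "map_poly \<sigma> (P * Q) = map_poly \<sigma> P * map_poly \<sigma> Q"
proof (rule poly_eqI)
  fix i
  have "\<sigma> (\<Sum>j\<le>i. coeff P j * coeff Q (i - j)) = (\<Sum>j\<le>i. \<sigma> (coeff P j) * \<sigma> (coeff Q (i - j)))"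
    using assms by (subst hom_sum) (auto simp: hom_mult polysD intro!: subring_mult K)
  then show "coeff (map_poly \<sigma> (P * Q)) i = coeff (map_poly \<sigma> P * map_poly \<sigma> Q) i"
    by (simp add: coeff_hom coeff_mult)
qed

lemma map_poly_hom_1: "map_poly \<sigma> 1 = 1"
  by (simp add: hom_1)

lemma poly_map_hom: "P \<in> polys K \<Longrightarrow> x \<in> K \<Longrightarrow> poly (map_poly \<sigma> P) (\<sigma> x) = \<sigma> (poly P x)"
proof (induction P)
  case 0
  then show ?case by (simp add: hom_0)
next
  case (pCons a P)
  have a: "a \<in> K" using polysD[OF pCons.prems(1), of 0] by simp
  have P: "P \<in> polys K" using polysD[OF pCons.prems(1), of "Suc _"] by (simp add: polys_def)
  have Px: "poly P x \<in> K" using poly_polys[OF K P] pCons.prems by simp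
  have "\<sigma> (poly (pCons a P) x) = \<sigma> a + \<sigma> x * \<sigma> (poly P x)"
    using a Px pCons.prems by (simp add: hom_add hom_mult subring_mult K)
  then show ?case using pCons.IH[OF P pCons.prems(2)] by (simp add: map_poly_hom_pCons)
qed

lemma degree_map_hom: "lead_coeff P = 1 \<Longrightarrow> degree (map_poly \<sigma> P) = degree P"
  by (rule degree_map_poly) (auto simp: hom_1)

lemma lead_coeff_map_hom: "lead_coeff P = 1 \<Longrightarrow> lead_coeff (map_poly \<sigma> P) = 1"
  by (simp add: degree_map_hom coeff_hom hom_1)

end

lemma hom_eq_0:
  assumes "is_subfield K" "hom_on K \<sigma>" "x \<in> K"
  shows "\<sigma> x = 0 \<longleftrightarrow> x = 0"
proof
  note K = subfield_subring[OF assms(1)]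
  assume "\<sigma> x = 0"
  show "x = 0"
  proof (rule ccontr)
    assume "x \<noteq> 0"
    then have "\<sigma> (x * inverse x) = 1" using hom_1[OF K assms(2)] by simp
    moreover have "\<sigma> (x * inverse x) = \<sigma> x * \<sigma> (inverse x)"
      by (rule hom_mult[OF K assms(2)]) (use assms in \<open>auto intro: subfield_inverse\<close>)
    ultimately show False using \<open>\<sigma> x = 0\<close> by simp
  qed
qed (use hom_0 assms subfield_subring in blast)

lemma hom_inverse:
  assumes "is_subfield K" "hom_on K \<sigma>" "x \<in> K"
  shows "\<sigma> (inverse x) = inverse (\<sigma> x)"
proof (cases "x = 0")
  case True
  then show ?thesis using hom_0[OF subfield_subring[OF assms(1)] assms(2)] by simp
next
  case False
  note K = subfield_subring[OF assms(1)]
  have "\<sigma> x * \<sigma> (inverse x) = \<sigma> (x * inverse x)"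
    by (rule hom_mult[OF K assms(2), symmetric]) (use assms in \<open>auto intro: subfield_inverse\<close>)
  also have "\<dots> = 1" using False hom_1[OF K assms(2)] by simp
  finally show ?thesis by (metis inverse_unique)
qed

lemma hom_divide:
  assumes "is_subfield K" "hom_on K \<sigma>" "x \<in> K" "y \<in> K"
  shows "\<sigma> (x / y) = \<sigma> x / \<sigma> y"
  using hom_mult[OF subfield_subring[OF assms(1)] assms(2,3) subfield_inverse[OF assms(1,4)]]
    hom_inverse[OF assms(1,2,4)] by (simp add: divide_inverse)

text \<open>The subfield generated by \<open>K\<close> and \<open>a\<close>. Writing its elements as fractions of polynomial values
covers algebraic and transcendental \<open>a\<close> at once.\<close>

definition adj :: "complex set \<Rightarrow> complex \<Rightarrow> complex set" where
  "adj K a = {poly A a / poly Q a | A Q. A \<in> polys K \<and> Q \<in> polys K \<and> poly Q a \<noteq> 0}"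

lemma adjI: "A \<in> polys K \<Longrightarrow> Q \<in> polys K \<Longrightarrow> poly Q a \<noteq> 0 \<Longrightarrow> poly A a / poly Q a \<in> adj K a"
  by (auto simp: adj_def)

lemma adjE:
  assumes "x \<in> adj K a"
  obtains A Q where "A \<in> polys K" "Q \<in> polys K" "poly Q a \<noteq> 0" "x = poly A a / poly Q a"
  using assms unfolding adj_def by (elim CollectE exE conjE) metis

lemma poly_adj: "is_subring K \<Longrightarrow> A \<in> polys K \<Longrightarrow> poly A a \<in> adj K a"
  using adjI[of A K 1 a] subring_1[OF subring_polys, of K] by simp

lemma subset_adj:
  assumes K: "is_subring K"
  shows "K \<subseteq> adj K a"
proof
  fix x assume "x \<in> K"
  then have "[:x:] \<in> polys K" by (intro pCons_polys K subring_0 subring_polys)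
  from poly_adj[OF K this] show "x \<in> adj K a" by simp
qed

lemma in_adj:
  assumes K: "is_subring K"
  shows "a \<in> adj K a"
proof -
  have "[:0, 1:] \<in> polys K" by (intro pCons_polys K subring_0 subring_1 subring_polys)
  from poly_adj[OF K this] show "a \<in> adj K a" by simp
qed

lemma subfield_adj:
  assumes "is_subfield K"
  shows "is_subfield (adj K a)"
proof -
  note K = subfield_subring[OF assms]
  note P = subring_polys[OF K]
  have "1 \<in> adj K a" using subset_adj[OF K] subring_1[OF K] by blast
  moreover have "x - y \<in> adj K a \<and> x * y \<in> adj K a" if xy: "x \<in> adj K a" "y \<in> adj K a" for x y
  proof -
    obtain A Q where 1: "A \<in> polys K" "Q \<in> polys K" "poly Q a \<noteq> 0" "x = poly A a / poly Q a"
      using xy(1) by (rule adjE)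
    obtain C D where 2: "C \<in> polys K" "D \<in> polys K" "poly D a \<noteq> 0" "y = poly C a / poly D a"
      using xy(2) by (rule adjE)
    have "x - y = poly (A * D - C * Q) a / poly (Q * D) a"
      unfolding 1(4) 2(4) using 1(3) 2(3) by (simp add: field_simps)
    moreover have "\<dots> \<in> adj K a"
      using 1 2 by (intro adjI subring_diff subring_mult P) auto
    moreover have "x * y = poly (A * C) a / poly (Q * D) a" using 1 2 by simp
    moreover have "\<dots> \<in> adj K a"
      using 1 2 by (intro adjI subring_diff subring_mult P) auto
    ultimately show ?thesis by simp
  qed
  moreover have "inverse x \<in> adj K a" if "x \<in> adj K a" for x
  proof -
    obtain A Q where 1: "A \<in> polys K" "Q \<in> polys K" "poly Q a \<noteq> 0" "x = poly A a / poly Q a"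
      using \<open>x \<in> adj K a\<close> by (rule adjE)
    show ?thesis
    proof (cases "poly A a = 0")
      case True
      then show ?thesis using 1 subset_adj[OF K, of a] subring_0[OF K] by auto
    next
      case False
      then show ?thesis using adjI[OF 1(2,1)] unfolding 1(4) by simp
    qed
  qed
  ultimately show ?thesis by (auto simp: is_subfield_def is_subring_def)
qed

lemma adj_least:
  assumes "is_subfield L" "K \<subseteq> L" "a \<in> L"
  shows "adj K a \<subseteq> L"
proof
  fix x assume "x \<in> adj K a"
  then obtain A Q where "A \<in> polys K" "Q \<in> polys K" "x = poly A a / poly Q a"
    by (rule adjE)
  then show "x \<in> L" using polys_mono[OF assms(2)] assms
    by (auto intro!: subfield_divide poly_polys subfield_subring)
qed

lemma countable_polys: "countable K \<Longrightarrow> countable (polys K)"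
proof -
  assume "countable K"
  then have "countable (Poly ` lists K)" by simp
  moreover have "polys K \<subseteq> Poly ` lists K"
  proof
    fix P assume "P \<in> polys K"
    then have "coeffs P \<in> lists K" by (auto simp: coeffs_def polys_def)
    then show "P \<in> Poly ` lists K" by (metis Poly_coeffs image_eqI)
  qed
  ultimately show ?thesis by (rule countable_subset[rotated])
qed

lemma countable_adj: "countable K \<Longrightarrow> countable (adj K a)"
proof -
  assume "countable K"
  then have "countable ((\<lambda>(A, Q). poly A a / poly Q a) ` (polys K \<times> polys K))"
    by (intro countable_image countable_SIGMA countable_polys)
  then show ?thesis by (rule countable_subset[rotated]) (force simp: adj_def)
qed

text \<open>The only condition for sending \<open>a\<close> to \<open>b\<close> is that both satisfy the same polynomial relations,
up to \<open>\<sigma>\<close>. For algebraic \<open>a\<close> this holds when \<open>b\<close> is a root of the conjugated minimal polynomial, and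
for transcendental \<open>a\<close> when \<open>b\<close> is transcendental over the image of \<open>\<sigma>\<close>.\<close>

lemma hom_extend:
  assumes K: "is_subfield K" and \<sigma>: "hom_on K \<sigma>"
    and same: "\<And>A. A \<in> polys K \<Longrightarrow> poly (map_poly \<sigma> A) b = 0 \<longleftrightarrow> poly A a = 0"
  shows "\<exists>\<tau>. hom_on (adj K a) \<tau> \<and> (\<forall>x\<in>K. \<tau> x = \<sigma> x) \<and>
    (\<forall>A\<in>polys K. \<forall>Q\<in>polys K. poly Q a \<noteq> 0 \<longrightarrow>
      \<tau> (poly A a / poly Q a) = poly (map_poly \<sigma> A) b / poly (map_poly \<sigma> Q) b)"
proof -
  note R = subfield_subring[OF K]
  note P = subring_polys[OF R]
  note h = map_poly_hom_diff[OF R \<sigma>] map_poly_hom_mult[OF R \<sigma>]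
  have "\<forall>x\<in>adj K a. \<exists>A Q. A \<in> polys K \<and> Q \<in> polys K \<and> poly Q a \<noteq> 0 \<and> x = poly A a / poly Q a"
    by (auto elim!: adjE)
  then obtain N D where ND: "\<And>x. x \<in> adj K a \<Longrightarrow> N x \<in> polys K \<and> D x \<in> polys K \<and>
    poly (D x) a \<noteq> 0 \<and> x = poly (N x) a / poly (D x) a" by metis
  define \<tau> where "\<tau> x = poly (map_poly \<sigma> (N x)) b / poly (map_poly \<sigma> (D x)) b" for x
  have \<tau>: "\<tau> (poly A a / poly Q a) = poly (map_poly \<sigma> A) b / poly (map_poly \<sigma> Q) b"
    if A: "A \<in> polys K" and Q: "Q \<in> polys K" "poly Q a \<noteq> 0" for A Q
  proof -
    define x where "x = poly A a / poly Q a"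
    define n d where "n = N x" and "d = D x"
    have x: "n \<in> polys K" "d \<in> polys K" "poly d a \<noteq> 0" "poly A a / poly Q a = poly n a / poly d a"
      using ND[of x] adjI[OF A Q] by (auto simp: x_def n_def d_def)
    have "poly (A * d - n * Q) a = 0"
      using x(3,4) Q(2) by (simp add: field_simps)
    moreover have "A * d - n * Q \<in> polys K" by (intro subring_diff subring_mult P A Q x)
    ultimately have "poly (map_poly \<sigma> (A * d - n * Q)) b = 0" using same by blast
    then have "poly (map_poly \<sigma> A) b * poly (map_poly \<sigma> d) b
       = poly (map_poly \<sigma> n) b * poly (map_poly \<sigma> Q) b"
      by (simp add: h A Q x(1,2) subring_mult P)
    moreover have "poly (map_poly \<sigma> Q) b \<noteq> 0" "poly (map_poly \<sigma> d) b \<noteq> 0"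
      using same Q x by auto
    ultimately have "poly (map_poly \<sigma> n) b / poly (map_poly \<sigma> d) b
       = poly (map_poly \<sigma> A) b / poly (map_poly \<sigma> Q) b" by (simp add: field_simps)
    then show ?thesis unfolding \<tau>_def x_def n_def d_def .
  qed
  have \<tau>\<sigma>: "\<tau> x = \<sigma> x" if "x \<in> K" for x
    using \<tau>[of "[:x:]" 1] that hom_1[OF R \<sigma>] hom_0[OF R \<sigma>]
      pCons_polys[OF R that subring_0[OF P]] subring_1[OF P] map_poly_hom_pCons[OF R \<sigma>]
    by (simp add: map_poly_hom_1[OF R \<sigma>])
  have "hom_on (adj K a) \<tau>"
    unfolding hom_on_def
  proof (intro conjI ballI)
    show "\<tau> 1 = 1" using \<tau>\<sigma>[OF subring_1[OF R]] hom_1[OF R \<sigma>] by simp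
    fix x y assume xy: "x \<in> adj K a" "y \<in> adj K a"
    obtain A Q where 1: "A \<in> polys K" "Q \<in> polys K" "poly Q a \<noteq> 0" "x = poly A a / poly Q a"
      using xy(1) by (rule adjE)
    obtain C E where 2: "C \<in> polys K" "E \<in> polys K" "poly E a \<noteq> 0" "y = poly C a / poly E a"
      using xy(2) by (rule adjE)
    have nz: "poly (map_poly \<sigma> Q) b \<noteq> 0" "poly (map_poly \<sigma> E) b \<noteq> 0" using same 1 2 by auto
    have "x - y = poly (A * E - C * Q) a / poly (Q * E) a"
      unfolding 1(4) 2(4) using 1(3) 2(3) by (simp add: field_simps)
    also have "\<tau> \<dots> = poly (map_poly \<sigma> (A * E - C * Q)) b / poly (map_poly \<sigma> (Q * E)) b"
      using 1 2 by (intro \<tau> subring_diff subring_mult P) auto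
    also have "\<dots> = \<tau> x - \<tau> y"
      unfolding 1(4) 2(4) using nz 1(1-3) 2(1-3) by (simp add: \<tau> h subring_mult P field_simps)
    finally show "\<tau> (x - y) = \<tau> x - \<tau> y" .
    have "x * y = poly (A * C) a / poly (Q * E) a" using 1 2 by simp
    also have "\<tau> \<dots> = poly (map_poly \<sigma> (A * C)) b / poly (map_poly \<sigma> (Q * E)) b"
      using 1 2 by (intro \<tau> subring_mult P) auto
    also have "\<dots> = \<tau> x * \<tau> y"
      unfolding 1(4) 2(4) using 1(1-3) 2(1-3) by (simp add: \<tau> h)
    finally show "\<tau> (x * y) = \<tau> x * \<tau> y" .
  qed
  then show ?thesis using \<tau> \<tau>\<sigma> by blast
qed

lemma polys_divide_monic:
  assumes K: "is_subring K" and \<mu>: "\<mu> \<in> polys K" "lead_coeff \<mu> = 1" and A: "A \<in> polys K"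
  shows "\<exists>C\<in>polys K. A - \<mu> * C = 0 \<or> degree (A - \<mu> * C) < degree \<mu>"
  using A
proof (induction "length (coeffs A)" arbitrary: A rule: less_induct)
  case less
  note P = subring_polys[OF K]
  show ?case
  proof (cases "A = 0 \<or> degree A < degree \<mu>")
    case True
    then show ?thesis using subring_0[OF P] by (intro bexI[of _ 0]) auto
  next
    case False
    define M where "M = monom (lead_coeff A) (degree A - degree \<mu>)"
    have M: "M \<in> polys K" unfolding M_def using less.prems by (intro monom_polys K polysD)
    define A' where "A' = A - \<mu> * M"
    have A': "A' \<in> polys K" unfolding A'_def by (intro subring_diff subring_mult P less.prems M \<mu>)
    have dM: "degree (\<mu> * M) \<le> degree A"
      using False degree_mult_le[of \<mu> M] degree_monom_le[of "lead_coeff A" "degree A - degree \<mu>"]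
      unfolding M_def by linarith
    have "coeff (\<mu> * M) (degree A) = lead_coeff A"
      using False \<mu>(2) by (auto simp: M_def coeff_monom_mult mult.commute[of \<mu>])
    then have c0: "coeff A' (degree A) = 0" by (simp add: A'_def)
    have dA': "degree A' \<le> degree A" unfolding A'_def by (rule degree_diff_le) (use dM in auto)
    have "length (coeffs A') < length (coeffs A)"
    proof (cases "A' = 0")
      case True
      then show ?thesis using False by (simp add: length_coeffs_degree)
    next
      case A'0: False
        have "degree A' \<noteq> degree A" using c0 A'0 by (metis leading_coeff_0_iff)
      then show ?thesis using dA' A'0 False by (simp add: length_coeffs_degree)
    qed
    from less.hyps[OF this A'] obtain C where C: "C \<in> polys K" 
      "A' - \<mu> * C = 0 \<or> degree (A' - \<mu> * C) < degree \<mu>" by blast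
    have "A - \<mu> * (M + C) = A' - \<mu> * C" by (simp add: A'_def algebra_simps)
    then show ?thesis using C subring_add[OF P M C(1)] by metis
  qed
qed

text \<open>Ideals of polynomials over a subfield are principal: a monic element of least degree divides all
others. The statement is used for the relations of an element and for the relations of a conjugate.\<close>

lemma ideal_generator:
  assumes K: "is_subfield K" and I: "I \<subseteq> polys K" "M \<in> I" "M \<noteq> 0"
    and diff: "\<And>A C. A \<in> I \<Longrightarrow> C \<in> I \<Longrightarrow> A - C \<in> I"
    and mult: "\<And>A C. A \<in> I \<Longrightarrow> C \<in> polys K \<Longrightarrow> A * C \<in> I"
  shows "\<exists>\<mu>\<in>I. lead_coeff \<mu> = 1 \<and> (\<forall>A\<in>I. \<exists>C\<in>polys K. A = \<mu> * C)"
proof -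
  note R = subfield_subring[OF K]
  note P = subring_polys[OF R]
  obtain \<nu> where \<nu>: "\<nu> \<in> I" "\<nu> \<noteq> 0" and min: "\<And>A. A \<in> I \<Longrightarrow> A \<noteq> 0 \<Longrightarrow> degree \<nu> \<le> degree A"
    using ex_has_least_nat[of "\<lambda>A. A \<in> I \<and> A \<noteq> 0" M degree] I by blast
  define \<mu> where "\<mu> = \<nu> * [:inverse (lead_coeff \<nu>):]"
  have "[:inverse (lead_coeff \<nu>):] \<in> polys K"
    using \<nu> I by (intro pCons_polys R subfield_inverse K polysD[of \<nu>] subring_0 P) auto
  then have \<mu>I: "\<mu> \<in> I" unfolding \<mu>_def using \<nu> by (intro mult)
  have \<mu>1: "lead_coeff \<mu> = 1" using \<nu> by (simp add: \<mu>_def)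
  have d: "degree \<mu> = degree \<nu>" using \<nu> by (simp add: \<mu>_def)
  have "\<exists>C\<in>polys K. A = \<mu> * C" if A: "A \<in> I" for A
  proof -
    obtain C where C: "C \<in> polys K" "A - \<mu> * C = 0 \<or> degree (A - \<mu> * C) < degree \<mu>"
      using polys_divide_monic[OF R _ \<mu>1] A \<mu>I I by blast
    have "A - \<mu> * C \<in> I" by (intro diff mult A \<mu>I C)
    then have "A - \<mu> * C = 0" using C(2) min d by force
    then show ?thesis using C(1) by auto
  qed
  then show ?thesis using \<mu>I \<mu>1 by blast
qed

lemma minimal_polynomial:
  assumes K: "is_subfield K" and a: "a \<in> icl K"
  obtains \<mu> where "\<mu> \<in> polys K" "lead_coeff \<mu> = 1" "poly \<mu> a = 0"
    "\<And>A. A \<in> polys K \<Longrightarrow> poly A a = 0 \<Longrightarrow> \<exists>C\<in>polys K. A = \<mu> * C"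
proof -
  note P = subring_polys[OF subfield_subring[OF K]]
  obtain M where "M \<in> polys K" "lead_coeff M = 1" "poly M a = 0" using a by (auto simp: icl_def)
  then have "\<exists>\<mu>\<in>{A\<in>polys K. poly A a = 0}. lead_coeff \<mu> = 1 \<and> 
    (\<forall>A\<in>{A\<in>polys K. poly A a = 0}. \<exists>C\<in>polys K. A = \<mu> * C)"
    by (intro ideal_generator[OF K, of _ M]) (auto intro: subring_diff subring_mult P)
  then show ?thesis using that by blast
qed

text \<open>The relations of \<open>b\<close> form an ideal with generator \<open>\<nu>\<close>, and the minimal polynomial \<open>\<mu>\<close> of \<open>a\<close> is
a multiple of \<open>\<nu>\<close>. If the cofactor vanished at \<open>a\<close>, it would be a multiple of \<open>\<mu>\<close>, which would make \<open>\<nu>\<close> a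
unit; so \<open>\<nu>\<close> vanishes at \<open>a\<close>, and so does every relation of \<open>b\<close>.\<close>

lemma conjugate_root_same_relations:
  assumes K: "is_subfield K" and \<sigma>: "hom_on K \<sigma>"
    and \<mu>: "\<mu> \<in> polys K" "lead_coeff \<mu> = 1" "poly \<mu> a = 0"
    and gen: "\<And>A. A \<in> polys K \<Longrightarrow> poly A a = 0 \<Longrightarrow> \<exists>C\<in>polys K. A = \<mu> * C"
    and b: "poly (map_poly \<sigma> \<mu>) b = 0" and A: "A \<in> polys K"
  shows "poly (map_poly \<sigma> A) b = 0 \<longleftrightarrow> poly A a = 0"
proof
  note R = subfield_subring[OF K]
  note P = subring_polys[OF R]
  note h = map_poly_hom_diff[OF R \<sigma>] map_poly_hom_mult[OF R \<sigma>]
  { assume "poly A a = 0"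
    then obtain C where "C \<in> polys K" "A = \<mu> * C" using gen A by blast
    then show "poly (map_poly \<sigma> A) b = 0" using b \<mu> by (simp add: h) }
  assume Ab: "poly (map_poly \<sigma> A) b = 0"
  define I where "I = {A\<in>polys K. poly (map_poly \<sigma> A) b = 0}"
  have "\<exists>\<nu>\<in>I. lead_coeff \<nu> = 1 \<and> (\<forall>A\<in>I. \<exists>C\<in>polys K. A = \<nu> * C)"
    by (intro ideal_generator[OF K, of _ \<mu>])
      (use \<mu> b in \<open>auto simp: I_def h subring_diff subring_mult P\<close>)
  then obtain \<nu> where \<nu>: "\<nu> \<in> I" "lead_coeff \<nu> = 1" "\<And>A. A \<in> I \<Longrightarrow> \<exists>C\<in>polys K. A = \<nu> * C" by blast
  obtain C where C: "C \<in> polys K" "\<mu> = \<nu> * C" using \<nu>(3)[of \<mu>] \<mu> b by (auto simp: I_def)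
  obtain D where D: "D \<in> polys K" "A = \<nu> * D" using \<nu>(3)[of A] A Ab by (auto simp: I_def)
  have "poly C a \<noteq> 0"
  proof
    assume "poly C a = 0"
    then obtain E where "C = \<mu> * E" using gen C by blast
    then have "\<mu> * (\<nu> * E) = \<mu> * 1" using C(2) by (metis mult.left_commute mult_1_right)
    moreover have "\<mu> \<noteq> 0" using \<mu>(2) by auto
    ultimately have "\<nu> * E = 1" using mult_cancel_left by blast
    moreover from this have "\<nu> \<noteq> 0" "E \<noteq> 0" by auto
    ultimately have "degree \<nu> = 0" using degree_mult_eq[of \<nu> E] by simp
    then obtain e where "\<nu> = [:e:]" using degree_eq_zeroE by blast
    then have "\<nu> = 1" using \<nu>(2) by (simp add: one_pCons)
    then show False using \<nu>(1) map_poly_hom_1[OF R \<sigma>] by (simp add: I_def)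
  qed
  then have "poly \<nu> a = 0" using C(2) \<mu>(3) by auto
  then show "poly A a = 0" using D by simp
qed

lemma hom_extend_root:
  assumes K: "is_subfield K" and \<sigma>: "hom_on K \<sigma>"
    and \<mu>: "\<mu> \<in> polys K" "lead_coeff \<mu> = 1" "poly \<mu> a = 0"
    and gen: "\<And>A. A \<in> polys K \<Longrightarrow> poly A a = 0 \<Longrightarrow> \<exists>C\<in>polys K. A = \<mu> * C"
    and b: "poly (map_poly \<sigma> \<mu>) b = 0"
  shows "\<exists>\<tau>. hom_on (adj K a) \<tau> \<and> (\<forall>x\<in>K. \<tau> x = \<sigma> x) \<and> \<tau> a = b"
proof -
  note R = subfield_subring[OF K]
  note P = subring_polys[OF R]
  obtain \<tau> where \<tau>: "hom_on (adj K a) \<tau>" "\<forall>x\<in>K. \<tau> x = \<sigma> x" 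
    "\<And>A Q. A \<in> polys K \<Longrightarrow> Q \<in> polys K \<Longrightarrow> poly Q a \<noteq> 0 \<Longrightarrow>
      \<tau> (poly A a / poly Q a) = poly (map_poly \<sigma> A) b / poly (map_poly \<sigma> Q) b"
    using hom_extend[OF K \<sigma> conjugate_root_same_relations[OF K \<sigma> \<mu> gen b]] by blast
  have X: "[:0, 1:] \<in> polys K" by (intro pCons_polys R subring_0 subring_1 P)
  have "\<tau> a = b"
    using \<tau>(3)[OF X subring_1[OF P]] 
    by (simp add: map_poly_hom_pCons[OF R \<sigma>] map_poly_hom_1[OF R \<sigma>] hom_0[OF R \<sigma>] hom_1[OF R \<sigma>])
  then show ?thesis using \<tau> by blast
qed

lemma hom_extend_algebraic:
  assumes K: "is_subfield K" and \<sigma>: "hom_on K \<sigma>" and a: "a \<in> icl K"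
  shows "\<exists>\<tau>. hom_on (adj K a) \<tau> \<and> (\<forall>x\<in>K. \<tau> x = \<sigma> x)"
proof -
  note R = subfield_subring[OF K]
  obtain \<mu> where \<mu>: "\<mu> \<in> polys K" "lead_coeff \<mu> = 1" "poly \<mu> a = 0"
    "\<And>A. A \<in> polys K \<Longrightarrow> poly A a = 0 \<Longrightarrow> \<exists>C\<in>polys K. A = \<mu> * C"
    using minimal_polynomial[OF K a] by metis
  have "degree \<mu> \<noteq> 0"
  proof
    assume "degree \<mu> = 0"
    then obtain e where "\<mu> = [:e:]" using degree_eq_zeroE by blast
    then show False using \<mu>(2,3) by simp
  qed
  then have "degree (map_poly \<sigma> \<mu>) \<noteq> 0" using degree_map_hom[OF R \<sigma> \<mu>(2)] by simp
  then have "\<exists>b. poly (map_poly \<sigma> \<mu>) b = 0"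
    using fundamental_theorem_of_algebra constant_degree by metis
  then show ?thesis using hom_extend_root[OF K \<sigma> \<mu>] by blast
qed

lemma hom_on_subset: "hom_on L \<tau> \<Longrightarrow> K \<subseteq> L \<Longrightarrow> hom_on K \<tau>"
  by (auto simp: hom_on_def subset_iff)

lemma minimal_polynomial_coeff_0:
  fixes K :: "complex set"
  assumes K: "is_subring K" and \<mu>: "\<mu> \<in> polys K" "lead_coeff \<mu> = 1" "poly \<mu> x = 0"
      "\<And>A. A \<in> polys K \<Longrightarrow> poly A x = 0 \<Longrightarrow> \<exists>C\<in>polys K. A = \<mu> * C" and "x \<noteq> 0"
  shows "coeff \<mu> 0 \<noteq> 0"
proof
  assume 0: "coeff \<mu> 0 = 0"
  obtain e \<nu> where \<nu>: "\<mu> = pCons e \<nu>" by (cases \<mu>)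
  then have "e = 0" using 0 by simp
  have "\<nu> \<noteq> 0" using \<mu>(2) \<nu> \<open>e = 0\<close> by auto
  have "\<nu> \<in> polys K" using \<mu>(1) by (auto simp: polys_def \<nu> coeff_pCons split: nat.splits)
  moreover have "poly \<nu> x = 0" using \<mu>(3) \<nu> \<open>e = 0\<close> \<open>x \<noteq> 0\<close> by simp
  ultimately obtain C where C: "\<nu> = \<mu> * C" using \<mu>(4) by blast
  then have "\<mu> \<noteq> 0" "C \<noteq> 0" using \<open>\<nu> \<noteq> 0\<close> by auto
  then have "degree \<nu> \<ge> degree \<mu>" using C by (simp add: degree_mult_eq)
  then show False using \<nu> \<open>\<nu> \<noteq> 0\<close> by simp
qed

text \<open>The inverse of an algebraic element is a root of the reflected minimal polynomial.\<close>

lemma subfield_icl: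
  fixes K :: "complex set"
  assumes K: "is_subfield K"
  shows "is_subfield (icl K)"
  unfolding is_subfield_def
proof (intro conjI ballI)
  note R = subfield_subring[OF K]
  show "is_subring (icl K)" by (rule subring_icl[OF R])
  fix x assume x: "x \<in> icl K"
  show "inverse x \<in> icl K"
  proof (cases "x = 0")
    case True
    then show ?thesis using x by simp
  next
    case False
    obtain \<mu> where \<mu>: "\<mu> \<in> polys K" "lead_coeff \<mu> = 1" "poly \<mu> x = 0"
      "\<And>A. A \<in> polys K \<Longrightarrow> poly A x = 0 \<Longrightarrow> \<exists>C\<in>polys K. A = \<mu> * C"
      using minimal_polynomial[OF K x] by metis
    have c0: "coeff \<mu> 0 \<noteq> 0" by (rule minimal_polynomial_coeff_0[OF R \<mu> False])
    define c where "c = coeff \<mu> 0"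
    define Q where "Q = Polynomial.smult (inverse c) (reflect_poly \<mu>)"
    have "c \<in> K" using \<mu>(1) by (simp add: c_def polysD)
    have "reflect_poly \<mu> \<in> polys K"
      using \<mu>(1) by (auto simp: polys_def coeff_reflect_poly intro: subring_0 R)
    then have Q: "Q \<in> polys K" unfolding Q_def 
      using \<open>c \<in> K\<close> by (intro smult_polys R subfield_inverse K)
    have "lead_coeff Q = 1" unfolding Q_def using c0 \<mu>(2) by (simp add: c_def coeff_reflect_poly)
    moreover have "poly Q (inverse x) = 0"
      unfolding Q_def using False \<mu>(3) by (simp add: poly_reflect_poly_nz)
    ultimately show ?thesis using Q by (auto simp: icl_def)
  qed
qed

lemma adj_subset_icl:
  assumes K: "is_subfield K" and a: "a \<in> icl K"
  shows "adj K a \<subseteq> icl K"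
  by (rule adj_least[OF subfield_icl[OF K] icl_base[OF subfield_subring[OF K]] a])

text \<open>The constant coefficient is, up to sign, the product of the roots. This lemma and the next use
this product in place of a norm: a lower bound for the norm forces one root to be large.\<close>

lemma monic_poly_0_bound:
  fixes \<mu> :: "complex poly"
  assumes \<mu>: "lead_coeff \<mu> = 1" and r: "\<And>b. poly \<mu> b = 0 \<Longrightarrow> cmod b \<le> \<theta>"
  shows "cmod (poly \<mu> 0) \<le> \<theta> ^ degree \<mu>"
proof -
  have "\<mu> \<noteq> 0" using \<mu> by auto
  have *: "cmod (\<Prod>b\<in>#S. - b) \<le> \<theta> ^ size S" if "\<And>b. b \<in># S \<Longrightarrow> cmod b \<le> \<theta>" for S
    using that
  proof (induction S)
    case (add b S)
    then have "cmod (\<Prod>b\<in>#S. - b) \<le> \<theta> ^ size S" "cmod b \<le> \<theta>" by auto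
    moreover from this have "0 \<le> \<theta>" using norm_ge_zero order_trans by blast
    ultimately show ?case by (simp add: norm_mult mult_mono)
  qed simp
  have "poly \<mu> 0 = (\<Prod>b\<in>#proots \<mu>. - b)"
    using \<mu> by (subst complex_poly_decompose_multiset[symmetric]) (simp add: poly_prod_mset)
  then show ?thesis using *[of "proots \<mu>"] r \<open>\<mu> \<noteq> 0\<close> by (simp add: size_proots_complex)
qed

lemma monic_poly_0_subring:
  fixes \<mu> :: "complex poly"
  assumes B: "is_subring B" and \<mu>: "lead_coeff \<mu> = 1" and r: "\<And>b. poly \<mu> b = 0 \<Longrightarrow> b \<in> B"
  shows "poly \<mu> 0 \<in> B"
proof -
  have "\<mu> \<noteq> 0" using \<mu> by auto
  have *: "(\<Prod>b\<in>#S. - b) \<in> B" if "\<And>b. b \<in># S \<Longrightarrow> b \<in> B" for S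
    using that by (induction S) (auto intro: subring_1[OF B] subring_mult[OF B] subring_uminus[OF B])
  have "poly \<mu> 0 = (\<Prod>b\<in>#proots \<mu>. - b)"
    using \<mu> by (subst complex_poly_decompose_multiset[symmetric]) (simp add: poly_prod_mset)
  then show ?thesis using *[of "proots \<mu>"] r \<open>\<mu> \<noteq> 0\<close> by simp
qed

section \<open>Fields with controlled homomorphisms\<close>

definition zring :: "'a :: comm_ring_1 set \<Rightarrow> 'a set" where
  "zring G = \<Inter>{B. is_subring B \<and> G \<subseteq> B}"

lemma subring_zring: "is_subring (zring G)"
  unfolding is_subring_def zring_def by (auto intro: subring_1 subring_diff subring_mult)

lemma zring_base: "G \<subseteq> zring G"
  by (auto simp: zring_def)

lemma zring_least: "is_subring B \<Longrightarrow> G \<subseteq> B \<Longrightarrow> zring G \<subseteq> B"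
  by (auto simp: zring_def)

text \<open>If \<open>p\<close> is a common denominator of the coefficients \<open>F\<close> of a dynamical system, then all its
preperiodic points become integral over this ring after multiplication by \<open>p\<close>.\<close>

definition scaled_ring :: "'a :: comm_ring_1 \<Rightarrow> 'a set \<Rightarrow> 'a set" where
  "scaled_ring p F = zring (insert p ((*) p ` F))"

lemma
  shows subring_scaled_ring: "is_subring (scaled_ring p F)"
    and scaled_ring_p: "p \<in> scaled_ring p F"
    and scaled_ring_F: "x \<in> F \<Longrightarrow> p * x \<in> scaled_ring p F"
    and scaled_ring_least: "is_subring B \<Longrightarrow> p \<in> B \<Longrightarrow> (\<And>x. x \<in> F \<Longrightarrow> p * x \<in> B) \<Longrightarrow> scaled_ring p F \<subseteq> B"
  using zring_base[of "insert p ((*) p ` F)"] zring_least[of B "insert p ((*) p ` F)"]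
  by (auto simp: scaled_ring_def subring_zring)

text \<open>This property takes the place of the product formula. In a number field a nonzero algebraic
integer has a conjugate of modulus at least 1; here the conjugates are the homomorphisms into the complex
numbers, and integers are the elements integral over \<open>scaled_ring p F\<close>. For a field with transcendental
elements one must choose homomorphisms under which the given finite set \<open>F\<close> and the denominator \<open>p\<close> stay
bounded by a constant that does not depend on \<open>u\<close>. The bound \<open>\<theta> < 1\<close> in place of 1 leaves room to perturb
the image of a transcendental generator. Countability of \<open>K\<close> provides transcendental images.\<close>

definition controlled :: "complex set \<Rightarrow> complex set \<Rightarrow> complex \<Rightarrow> real \<Rightarrow> bool" where
  "controlled K F p M \<longleftrightarrow> is_subfield K \<and> countable K \<and> F \<subseteq> K \<and> p \<in> K \<and> p \<noteq> 0 \<and>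
     (\<forall>u\<in>K. \<forall>\<theta><1. u \<noteq> 0 \<and> u \<in> icl (scaled_ring p F) \<longrightarrow>
       (\<exists>\<sigma>. hom_on K \<sigma> \<and> \<theta> < cmod (\<sigma> u) \<and> (\<forall>x\<in>insert p F. cmod (\<sigma> x) \<le> M)))"

text \<open>Adjoining an algebraic element changes neither the denominator nor the bound. The constant
coefficient of the minimal polynomial of \<open>u\<close> lies in \<open>K\<close> and is integral, because all conjugates of \<open>u\<close>
satisfy the same monic equation. A homomorphism of \<open>K\<close> that makes it large sends the minimal polynomial to one
with a large root, and \<open>u\<close> can be mapped to that root. This uniformity matters: the preperiodic points under
consideration are adjoined in this way, and there are arbitrarily many of them.\<close>

lemma controlled_adj_algebraic:
  assumes c: "controlled K F p M" and a: "a \<in> icl K"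
  shows "controlled (adj K a) F p M"
proof -
  from c have K: "is_subfield K" "countable K" "F \<subseteq> K" "p \<in> K" "p \<noteq> 0"
    and ex: "\<And>u \<theta>. u \<in> K \<Longrightarrow> \<theta> < 1 \<Longrightarrow> u \<noteq> 0 \<Longrightarrow> u \<in> icl (scaled_ring p F) \<Longrightarrow>
      \<exists>\<sigma>. hom_on K \<sigma> \<and> \<theta> < cmod (\<sigma> u) \<and> (\<forall>x\<in>insert p F. cmod (\<sigma> x) \<le> M)"
    by (auto simp: controlled_def)
  note R = subfield_subring[OF K(1)]
  define B where "B = scaled_ring p F"
  have B: "is_subring B" unfolding B_def by (rule subring_scaled_ring)
  have BK: "B \<subseteq> K" unfolding B_def using K by (intro scaled_ring_least R) (auto intro: subring_mult R)
  have "\<exists>\<tau>. hom_on (adj K a) \<tau> \<and> \<theta> < cmod (\<tau> u) \<and> (\<forall>x\<in>insert p F. cmod (\<tau> x) \<le> M)"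
    if u: "u \<in> adj K a" "u \<noteq> 0" "u \<in> icl B" and "\<theta> < 1" for u \<theta>
  proof -
    have uK: "u \<in> icl K" using icl_mono[OF BK] u by blast
    obtain \<mu> where \<mu>: "\<mu> \<in> polys K" "lead_coeff \<mu> = 1" "poly \<mu> u = 0"
      "\<And>A. A \<in> polys K \<Longrightarrow> poly A u = 0 \<Longrightarrow> \<exists>C\<in>polys K. A = \<mu> * C"
      using minimal_polynomial[OF K(1) uK] by metis
    define n where "n = degree \<mu>"
    have c0: "poly \<mu> 0 \<noteq> 0" using minimal_polynomial_coeff_0[OF R \<mu> u(2)] by (simp add: poly_0_coeff_0)
    have c0K: "poly \<mu> 0 \<in> K" using polysD[OF \<mu>(1)] by (simp add: poly_0_coeff_0)
    obtain P where P: "P \<in> polys B" "lead_coeff P = 1" "poly P u = 0" using u(3) by (auto simp: icl_def)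
    then obtain C where C: "P = \<mu> * C" using \<mu>(4) polys_mono[OF BK] by blast
    have "poly \<mu> 0 \<in> icl B"
      by (rule monic_poly_0_subring[OF subring_icl[OF B] \<mu>(2)]) (use P C in \<open>auto simp: icl_def\<close>)
    moreover have n0: "n \<noteq> 0"
    proof
      assume "n = 0"
      then obtain e where "\<mu> = [:e:]" using degree_eq_zeroE unfolding n_def by blast
      then show False using \<mu>(2,3) by simp
    qed
    \<comment> \<open>A negative \<open>\<theta>\<close> would spoil the monotonicity of its powers.\<close>
    define \<theta>' where "\<theta>' = max \<theta> 0"
    have \<theta>': "0 \<le> \<theta>'" "\<theta>' < 1" "\<theta> \<le> \<theta>'" using \<open>\<theta> < 1\<close> by (auto simp: \<theta>'_def)
    have "\<theta>' ^ n < 1" using \<theta>' n0 by (simp add: power_less_one_iff)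
    ultimately obtain \<sigma> where \<sigma>: "hom_on K \<sigma>" "\<theta>' ^ n < cmod (\<sigma> (poly \<mu> 0))" 
      "\<forall>x\<in>insert p F. cmod (\<sigma> x) \<le> M"
      using ex[OF c0K _ c0] unfolding B_def by blast
    define \<nu> where "\<nu> = map_poly \<sigma> \<mu>"
    have "poly \<nu> 0 = \<sigma> (poly \<mu> 0)" 
      using coeff_hom[OF R \<sigma>(1), of \<mu> 0] by (simp add: \<nu>_def poly_0_coeff_0)
    moreover have "degree \<nu> = n" unfolding \<nu>_def n_def by (rule degree_map_hom[OF R \<sigma>(1) \<mu>(2)])
    moreover have "lead_coeff \<nu> = 1" unfolding \<nu>_def by (rule lead_coeff_map_hom[OF R \<sigma>(1) \<mu>(2)])
    ultimately obtain b where b: "poly \<nu> b = 0" "\<theta>' < cmod b"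
      using monic_poly_0_bound[of \<nu> \<theta>'] \<sigma>(2) by force
    obtain \<tau> where \<tau>: "hom_on (adj K u) \<tau>" "\<forall>x\<in>K. \<tau> x = \<sigma> x" "\<tau> u = b"
      using hom_extend_root[OF K(1) \<sigma>(1) \<mu> b(1)[unfolded \<nu>_def]] by blast
    have Ku: "K \<subseteq> adj K u" "u \<in> adj K u" "is_subfield (adj K u)"
      using subset_adj[OF R] in_adj[OF R] subfield_adj[OF K(1)] by auto
    have "a \<in> icl (adj K u)" using icl_mono[OF Ku(1)] a by blast
    then obtain \<tau>' where \<tau>': "hom_on (adj (adj K u) a) \<tau>'" "\<forall>x\<in>adj K u. \<tau>' x = \<tau> x"
      using hom_extend_algebraic[OF Ku(3) \<tau>(1)] by blast
    have "adj K a \<subseteq> adj (adj K u) a"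
      using subset_adj[OF subfield_subring[OF Ku(3)], of a] in_adj[OF subfield_subring[OF Ku(3)], of a] Ku
      by (intro adj_least subfield_adj K) auto
    then have "hom_on (adj K a) \<tau>'" using hom_on_subset \<tau>'(1) by blast
    moreover have "\<theta> < cmod (\<tau>' u)" using \<tau>' \<tau> Ku b \<theta>' by auto
    moreover have "\<forall>x\<in>insert p F. cmod (\<tau>' x) \<le> M"
      using \<sigma>(3) \<tau>'(2) \<tau>(2) Ku(1) K(3,4) by (auto simp: subset_iff)
    ultimately show ?thesis by blast
  qed
  then show ?thesis unfolding controlled_def B_def
    using K subset_adj[OF R, of a] subfield_adj[OF K(1)] countable_adj[OF K(2)] by blast
qed

text \<open>The polynomial \<open>p\<^sup>D P(X/p)\<close>, which has the root \<open>p x\<close> when \<open>P\<close> has the root \<open>x\<close>. Coefficients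
are weighted by powers of \<open>p\<close>, as in a homogenization of degree \<open>D\<close>; this weighting is compatible with products
and with composition, while the naive clearing of denominators is not.\<close>

definition rescale :: "'a :: field \<Rightarrow> nat \<Rightarrow> 'a poly \<Rightarrow> 'a poly" where
  "rescale p D P = Polynomial.smult (p ^ D) (pcompose P [:0, inverse p:])"

lemma coeff_rescale: "p \<noteq> 0 \<Longrightarrow> i \<le> D \<Longrightarrow> coeff (rescale p D P) i = p ^ (D - i) * coeff P i"
proof -
  assume p: "p \<noteq> 0" and "i \<le> D"
  then have "p ^ D = p ^ (D - i) * p ^ i" by (simp flip: power_add)
  then show ?thesis using p by (simp add: rescale_def coeff_pcompose_linear power_inverse field_simps)
qed

lemma degree_rescale: "p \<noteq> 0 \<Longrightarrow> degree (rescale p D P) = degree P"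
  by (simp add: rescale_def degree_pcompose)

lemma monic_weighted_coeff:
  assumes B: "is_subring B" "p \<in> B"
    and P: "lead_coeff P = 1" "\<And>i. p * coeff P i \<in> B" and i: "i \<le> degree P"
  shows "p ^ (degree P - i) * coeff P i \<in> B"
proof (cases "i = degree P")
  case True
  then show ?thesis using P(1) subring_1[OF B(1)] by simp
next
  case False
  then obtain k where k: "degree P - i = Suc k" using i by (metis Suc_diff_Suc le_neq_implies_less)
  have "p ^ k * (p * coeff P i) \<in> B" by (rule subring_mult[OF B(1) subring_power[OF B] P(2)])
  then show ?thesis by (simp add: k mult_ac)
qed

lemma monic_rescale_polys:
  assumes B: "is_subring B" "p \<in> B" and p: "p \<noteq> 0"
    and P: "lead_coeff P = 1" "\<And>i. p * coeff P i \<in> B"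
  shows "rescale p (degree P) P \<in> polys B"
  unfolding polys_def
proof (intro CollectI allI)
  fix i
  show "coeff (rescale p (degree P) P) i \<in> B"
    using monic_weighted_coeff[OF B P, of i] p subring_0[OF B(1)]
    by (cases "i \<le> degree P") (auto simp: coeff_rescale coeff_eq_0 degree_rescale)
qed

lemma icl_rescale_root:
  fixes p :: "'a :: field"
  assumes p: "p \<noteq> 0" and P: "lead_coeff P = 1" "poly P x = 0" and c: "rescale p (degree P) P \<in> polys B"
  shows "p * x \<in> icl B"
proof -
  define Q where "Q = rescale p (degree P) P"
  have "lead_coeff Q = 1" using P(1) p by (simp add: Q_def degree_rescale coeff_rescale)
  moreover have "poly Q (p * x) = 0" unfolding Q_def rescale_def using P(2) p
    by (simp add: poly_pcompose mult.commute[of p] mult.assoc)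
  ultimately show ?thesis using c by (auto simp: icl_def Q_def)
qed

lemma monic_poly_lower_bound:
  assumes P: "lead_coeff P = 1" and M: "\<And>i. cmod (coeff P i) \<le> M"
    and z: "1 \<le> cmod z" "of_nat (degree P) * M < cmod z"
  shows "cmod z ^ degree P \<le> cmod (poly P z) + of_nat (degree P) * M * cmod z ^ (degree P - 1)"
proof -
  define n where "n = degree P"
  have M0: "0 \<le> M" using M[of 0] norm_ge_zero order_trans by blast
  have "poly P z = (\<Sum>i<n. coeff P i * z ^ i) + z ^ n"
    using P by (simp add: poly_altdef n_def lessThan_Suc_atMost[symmetric])
  then have "z ^ n = poly P z - (\<Sum>i<n. coeff P i * z ^ i)" by simp
  then have "cmod z ^ n \<le> cmod (poly P z) + cmod (\<Sum>i<n. coeff P i * z ^ i)"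
    by (metis norm_power norm_triangle_ineq4)
  also have "cmod (\<Sum>i<n. coeff P i * z ^ i) \<le> (\<Sum>i<n. M * cmod z ^ (n - 1))"
  proof (rule sum_norm_le)
    fix i assume "i \<in> {..<n}"
    then have "cmod z ^ i \<le> cmod z ^ (n - 1)" using z by (intro power_increasing) auto
    then show "cmod (coeff P i * z ^ i) \<le> M * cmod z ^ (n - 1)"
      using M M0 by (simp add: norm_mult norm_power mult_mono)
  qed
  finally show ?thesis by (simp add: n_def mult_ac)
qed

text \<open>With the surplus \<open>r\<close> this is an escape estimate: outside a disc a monic polynomial of degree at
least 2 increases the modulus.\<close>

lemma monic_poly_large:
  assumes P: "lead_coeff P = 1" and M: "\<And>i. cmod (coeff P i) \<le> M"
    and z: "1 + of_nat (degree P) * M + r \<le> cmod z" and "0 \<le> r" "0 < degree P"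
  shows "cmod z ^ (degree P - 1) * (1 + r) \<le> cmod (poly P z)"
proof -
  have M0: "0 \<le> M" using M[of 0] norm_ge_zero order_trans by blast
  then have nM: "0 \<le> of_nat (degree P) * M" by simp
  have z1: "1 \<le> cmod z" "of_nat (degree P) * M < cmod z" using z nM \<open>0 \<le> r\<close> by linarith+
  have "cmod z ^ degree P = cmod z ^ (degree P - 1) * cmod z"
    using \<open>0 < degree P\<close> by (simp flip: power_Suc2)
  with monic_poly_lower_bound[OF P M z1]
  have "cmod z ^ (degree P - 1) * (cmod z - of_nat (degree P) * M) \<le> cmod (poly P z)"
    by (simp add: algebra_simps)
  moreover have "cmod z ^ (degree P - 1) * (1 + r) \<le> cmod z ^ (degree P - 1) * (cmod z - of_nat (degree P) * M)"
    using z by (intro mult_left_mono) auto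
  ultimately show ?thesis by linarith
qed

lemma monic_root_bound:
  assumes P: "lead_coeff P = 1" and M: "\<And>i. cmod (coeff P i) \<le> M" and z: "poly P z = 0"
  shows "cmod z \<le> 1 + of_nat (degree P) * M"
proof (rule ccontr)
  assume *: "\<not> ?thesis"
  have "degree P \<noteq> 0"
  proof
    assume "degree P = 0"
    then obtain e where "P = [:e:]" using degree_eq_zeroE by blast
    then show False using P z by simp
  qed
  have "0 \<le> M" using M[of 0] norm_ge_zero order_trans by blast
  then have "0 \<le> of_nat (degree P) * M" by simp
  then have "0 < cmod z" using * by linarith
  then have "0 < cmod z ^ (degree P - 1)" by simp
  moreover have "cmod z ^ (degree P - 1) * (1 + 0) \<le> cmod (poly P z)"
    by (rule monic_poly_large[OF P M]) (use * \<open>degree P \<noteq> 0\<close> in auto)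
  ultimately show False using z by simp
qed

lemma poly_norm_bound:
  assumes M: "\<And>i. cmod (coeff P i) \<le> M" and n: "degree P \<le> n" and z: "cmod z \<le> R"
  shows "cmod (poly P z) \<le> (\<Sum>i\<le>n. M * R ^ i)"
proof -
  have M0: "0 \<le> M" using M[of 0] norm_ge_zero order_trans by blast
  have "poly P z = (\<Sum>i\<le>n. coeff P i * z ^ i)" unfolding poly_altdef
    using n by (intro sum.mono_neutral_left) (auto simp: coeff_eq_0)
  also have "cmod \<dots> \<le> (\<Sum>i\<le>n. M * R ^ i)"
    using M M0 z by (intro sum_norm_le) (auto simp: norm_mult norm_power intro!: mult_mono power_mono)
  finally show ?thesis .
qed

text \<open>The denominator and the bound depend on the finite set \<open>F\<close> only. The quantifier over all \<open>F\<close>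
is what makes the property inductive along a chain of simple extensions, since a finite set in the extension is
described by a finite set in the base field.\<close>

definition controllable :: "complex set \<Rightarrow> bool" where
  "controllable K \<longleftrightarrow> is_subfield K \<and> countable K \<and>
     (\<forall>F. finite F \<and> F \<subseteq> K \<longrightarrow> (\<exists>p M. controlled K F p M))"

lemma finite_Rats_common_denominator:
  "finite F \<Longrightarrow> F \<subseteq> \<rat> \<Longrightarrow> \<exists>d::nat. d \<noteq> 0 \<and> (\<forall>x\<in>F. of_nat d * (x :: complex) \<in> \<int>)"
proof (induction F rule: finite_induct)
  case empty
  show ?case by (rule exI[of _ 1]) auto
next
  case (insert x F)
  then obtain d where d: "d \<noteq> 0" "\<forall>x\<in>F. of_nat d * x \<in> \<int>" by auto
  obtain a b where ab: "b > 0" "x = of_int a / of_int b" using insert.prems by (auto elim: Rats_cases')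
  have nb: "(of_nat (nat b) :: complex) = of_int b" using ab(1) by simp
  have "of_nat (nat b * d) * y \<in> \<int>" if "y \<in> insert x F" for y
  proof (cases "y \<in> F")
    case True
    then have "of_nat d * y \<in> \<int>" using d(2) by blast
    then have "of_nat (nat b) * (of_nat d * y) \<in> \<int>" by (rule Ints_mult[OF Ints_of_nat])
    then show ?thesis by (metis mult.assoc of_nat_mult)
  next
    case False
    then have "of_nat (nat b * d) * y = of_nat d * of_int a" 
      using that ab by (simp add: nb)
    then show ?thesis by (metis Ints_mult Ints_of_int Ints_of_nat)
  qed
  then show ?case using d ab by (intro exI[of _ "nat b * d"]) auto
qed

text \<open>Over the rationals \<open>p\<close> is a common denominator, integral elements are integers, and the identity is
a homomorphism under which a nonzero integer has modulus at least 1.\<close>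

lemma controllable_Rats: "controllable \<rat>"
proof -
  have K: "is_subfield (\<rat> :: complex set)" 
    by (auto simp: is_subfield_def is_subring_def)
  have Z: "is_subring (\<int> :: complex set)" by (auto simp: is_subring_def)
  have "countable (\<rat> :: complex set)" unfolding Rats_def by simp
  moreover have "\<exists>p M. controlled \<rat> F p M" if F: "finite F" "F \<subseteq> \<rat>" for F
  proof -
    obtain d :: nat where d: "d \<noteq> 0" "\<forall>x\<in>F. of_nat d * x \<in> \<int>"
      using finite_Rats_common_denominator[OF F] by blast
    define M where "M = (\<Sum>x\<in>insert (of_nat d) F. cmod x)"
    have M: "cmod x \<le> M" if "x \<in> insert (of_nat d) F" for x
      unfolding M_def by (rule member_le_sum) (use that F in auto)
    have sub: "scaled_ring (of_nat d) F \<subseteq> \<int>" using d by (intro scaled_ring_least Z) auto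
    have "\<exists>\<sigma>. hom_on \<rat> \<sigma> \<and> \<theta> < cmod (\<sigma> u) \<and> (\<forall>x\<in>insert (of_nat d) F. cmod (\<sigma> x) \<le> M)"
      if u: "u \<in> \<rat>" "u \<noteq> 0" "u \<in> icl (scaled_ring (of_nat d) F)" "\<theta> < 1" for u \<theta>
    proof -
      have "u \<in> icl \<int>" using icl_mono[OF sub] u(3) by blast
      then have "algebraic_int u" by (auto simp: icl_def polys_def intro: algebraic_int.intros)
      then have "u \<in> \<int>" using u(1) rational_algebraic_int_is_int by blast
      then obtain k where "u = of_int k" by (auto elim: Ints_cases)
      then have "1 \<le> cmod u" using u(2) by simp
      then show ?thesis using M u(4) by (intro exI[of _ "\<lambda>x. x"]) (auto simp: hom_on_def)
    qed
    then have "controlled \<rat> F (of_nat d) M" unfolding controlled_def 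
      using K F d \<open>countable \<rat>\<close> by auto
    then show ?thesis by blast
  qed
  ultimately show ?thesis using K by (auto simp: controllable_def)
qed

lemma controlledD:
  assumes "controlled K F p M"
  shows "is_subfield K" "countable K" "F \<subseteq> K" "p \<in> K" "p \<noteq> 0" "0 \<le> M"
    and "u \<in> K \<Longrightarrow> \<theta> < 1 \<Longrightarrow> u \<noteq> 0 \<Longrightarrow> u \<in> icl (scaled_ring p F) \<Longrightarrow>
      \<exists>\<sigma>. hom_on K \<sigma> \<and> \<theta> < cmod (\<sigma> u) \<and> (\<forall>x\<in>insert p F. cmod (\<sigma> x) \<le> M)"
proof -
  show 1: "is_subfield K" "countable K" "F \<subseteq> K" "p \<in> K" "p \<noteq> 0" 
    and ex: "u \<in> K \<Longrightarrow> \<theta> < 1 \<Longrightarrow> u \<noteq> 0 \<Longrightarrow> u \<in> icl (scaled_ring p F) \<Longrightarrow>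
      \<exists>\<sigma>. hom_on K \<sigma> \<and> \<theta> < cmod (\<sigma> u) \<and> (\<forall>x\<in>insert p F. cmod (\<sigma> x) \<le> M)" for u \<theta>
    using assms unfolding controlled_def by blast+
  have "1 \<in> icl (scaled_ring p F)" by (intro subring_1 subring_icl subring_scaled_ring)
  then obtain \<sigma> where "\<forall>x\<in>insert p F. cmod (\<sigma> x) \<le> M"
    using ex[of 1 0] subring_1[OF subfield_subring[OF 1(1)]] by auto
  then show "0 \<le> M" using norm_ge_zero order_trans by blast
qed

text \<open>Every element of the finite set \<open>F\<close> is replaced by the coefficients of a monic equation for it.
Integrality over the new coefficients and a bound for its conjugates then follow from the equation.\<close>

lemma controllable_adj_algebraic:
  assumes c: "controllable K" and a: "a \<in> icl K"
  shows "controllable (adj K a)"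
proof -
  have K: "is_subfield K" "countable K" using c by (auto simp: controllable_def)
  note R = subfield_subring[OF K(1)]
  have "\<exists>p M. controlled (adj K a) F p M" if F: "finite F" "F \<subseteq> adj K a" for F
  proof -
    have "\<forall>x\<in>F. \<exists>P\<in>polys K. lead_coeff P = 1 \<and> poly P x = 0"
      using F adj_subset_icl[OF K(1) a] by (auto simp: icl_def)
    then obtain P where P: "\<And>x. x \<in> F \<Longrightarrow> P x \<in> polys K" "\<And>x. x \<in> F \<Longrightarrow> lead_coeff (P x) = 1" 
      "\<And>x. x \<in> F \<Longrightarrow> poly (P x) x = 0" by metis
    define F' where "F' = (\<Union>x\<in>F. range (coeff (P x)))"
    have "finite F'" unfolding F'_def using F finite_range_coeff by blast
    moreover have "F' \<subseteq> K" using P(1) by (auto simp: F'_def polys_def)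
    ultimately obtain p M where "controlled K F' p M" using c by (auto simp: controllable_def)
    note ctrl = controlled_adj_algebraic[OF this a]
    note D = controlledD[OF ctrl]
    define N where "N = (\<Sum>x\<in>F. degree (P x))"
    define M' where "M' = M + 1 + of_nat N * M"
    define B where "B = scaled_ring p F'"
    have B: "is_subring B" unfolding B_def by (rule subring_scaled_ring)
    have pB: "p \<in> B" unfolding B_def by (rule scaled_ring_p)
    have "scaled_ring p F \<subseteq> icl B"
    proof (intro scaled_ring_least subring_icl B)
      show "p \<in> icl B" using pB icl_base[OF B] by blast
      fix x assume x: "x \<in> F"
      have "p * coeff (P x) i \<in> B" for i
      proof -
        have "coeff (P x) i \<in> F'" unfolding F'_def using x by blast
        then show ?thesis unfolding B_def by (rule scaled_ring_F)
      qed
      then show "p * x \<in> icl B"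
        by (intro icl_rescale_root[OF D(5) P(2,3)[OF x]] monic_rescale_polys[OF B pB D(5) P(2)[OF x]])
    qed
    then have sub: "icl (scaled_ring p F) \<subseteq> icl B" using icl_mono icl_icl[OF B] by blast
    have "\<exists>\<sigma>. hom_on (adj K a) \<sigma> \<and> \<theta> < cmod (\<sigma> u) \<and> (\<forall>x\<in>insert p F. cmod (\<sigma> x) \<le> M')"
      if u: "u \<in> adj K a" "u \<noteq> 0" "u \<in> icl (scaled_ring p F)" "\<theta> < 1" for u \<theta>
    proof -
      obtain \<sigma> where \<sigma>: "hom_on (adj K a) \<sigma>" "\<theta> < cmod (\<sigma> u)" "\<forall>x\<in>insert p F'. cmod (\<sigma> x) \<le> M"
        using D(7)[of u \<theta>] u sub unfolding B_def by blast
      note RL = subfield_subring[OF D(1)]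
      have "cmod (\<sigma> x) \<le> M'" if x: "x \<in> F" for x
      proof -
        have Px: "P x \<in> polys (adj K a)" using P(1)[OF x] polys_mono[OF subset_adj[OF R]] by blast
        have "cmod (\<sigma> x) \<le> 1 + of_nat (degree (map_poly \<sigma> (P x))) * M"
        proof (rule monic_root_bound)
          show "lead_coeff (map_poly \<sigma> (P x)) = 1" by (rule lead_coeff_map_hom[OF RL \<sigma>(1) P(2)[OF x]])
          show "cmod (coeff (map_poly \<sigma> (P x)) i) \<le> M" for i
            using \<sigma>(3) x by (auto simp: coeff_hom[OF RL \<sigma>(1)] F'_def)
          show "poly (map_poly \<sigma> (P x)) (\<sigma> x) = 0"
            using poly_map_hom[OF RL \<sigma>(1) Px] x F P(3)[OF x] hom_0[OF RL \<sigma>(1)] by auto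
        qed
        also have "degree (map_poly \<sigma> (P x)) = degree (P x)" by (rule degree_map_hom[OF RL \<sigma>(1) P(2)[OF x]])
        also have "degree (P x) \<le> N" unfolding N_def using x F by (intro member_le_sum) auto
        finally show ?thesis using D(6) by (simp add: M'_def mult_right_mono)
      qed
      moreover have "M \<le> M'" using D(6) by (simp add: M'_def)
      ultimately show ?thesis using \<sigma> by (intro exI[of _ \<sigma>]) auto
    qed
    then have "controlled (adj K a) F p M'" using D(1-5) F unfolding controlled_def by blast
    then show ?thesis by blast
  qed
  then show ?thesis using K subfield_adj countable_adj by (auto simp: controllable_def)
qed

section \<open>Adjoining a transcendental number\<close>

lemma common_denominator:
  assumes K: "is_subfield K" and F: "finite F" "F \<subseteq> adj K t"
  shows "\<exists>q\<in>polys K. poly q t \<noteq> 0 \<and> (\<forall>x\<in>F. \<exists>A\<in>polys K. x = poly A t / poly q t)"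
  using F
proof (induction F rule: finite_induct)
  case empty
  show ?case using subring_1[OF subring_polys[OF subfield_subring[OF K]]] by (intro bexI[of _ 1]) auto
next
  case (insert x F)
  note P = subring_polys[OF subfield_subring[OF K]]
  obtain q where q: "q \<in> polys K" "poly q t \<noteq> 0" "\<forall>x\<in>F. \<exists>A\<in>polys K. x = poly A t / poly q t"
    using insert by auto
  obtain C D where CD: "C \<in> polys K" "D \<in> polys K" "poly D t \<noteq> 0" "x = poly C t / poly D t"
    using insert.prems by (auto elim: adjE)
  have "\<exists>A\<in>polys K. y = poly A t / poly (q * D) t" if "y \<in> insert x F" for y
  proof (cases "y \<in> F")
    case True
    then obtain A where "A \<in> polys K" "y = poly A t / poly q t" using q by blast
    then show ?thesis using CD q by (intro bexI[of _ "A * D"] subring_mult P) auto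
  next
    case False
    then have "y = x" using that by blast
    then show ?thesis using CD q by (intro bexI[of _ "q * C"] subring_mult P) auto
  qed
  then show ?case using q CD by (intro bexI[of _ "q * D"] subring_mult P) auto
qed

lemma root_of_unity_avoiding:
  assumes "(P :: complex poly) \<noteq> 0" and "c \<noteq> 0"
  shows "\<exists>\<zeta> n. n > 0 \<and> \<zeta> ^ n = 1 \<and> poly P (c * \<zeta>) \<noteq> 0"
proof (rule ccontr)
  assume *: "\<not> ?thesis"
  define n where "n = Suc (degree P)"
  have "finite {z. poly P z = 0}" by (rule poly_roots_finite[OF assms(1)])
  moreover have "(*) c ` {z. z ^ n = 1} \<subseteq> {z. poly P z = 0}"
  proof
    fix y assume "y \<in> (*) c ` {z. z ^ n = 1}"
    then obtain \<zeta> where "\<zeta> ^ n = 1" "y = c * \<zeta>" by auto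
    moreover have "n > 0" by (simp add: n_def)
    ultimately show "y \<in> {z. poly P z = 0}" using * by blast
  qed
  ultimately have "card ((*) c ` {z. z ^ n = 1}) \<le> card {z. poly P z = 0}" by (intro card_mono)
  also have "card ((*) c ` {z. z ^ n = 1}) = n"
    using \<open>c \<noteq> 0\<close> card_roots_unity_eq[of n] by (subst card_image) (auto simp: inj_on_def n_def)
  also have "card {z. poly P z = 0} \<le> degree P" using assms(1) card_poly_roots_bound by blast
  finally show False by (simp add: n_def)
qed

lemma countable_hom_image_icl:
  assumes K: "is_subfield K" "countable K" and \<sigma>: "hom_on K \<sigma>"
  shows "countable {b. \<exists>A\<in>polys K. A \<noteq> 0 \<and> poly (map_poly \<sigma> A) b = 0}"
proof -
  note R = subfield_subring[OF K(1)]
  have "{b. \<exists>A\<in>polys K. A \<noteq> 0 \<and> poly (map_poly \<sigma> A) b = 0}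
      = (\<Union>A\<in>polys K - {0}. {b. poly (map_poly \<sigma> A) b = 0})" by auto
  moreover have "countable {b. poly (map_poly \<sigma> A) b = 0}" if A: "A \<in> polys K - {0}" for A
  proof -
    have "coeff (map_poly \<sigma> A) (degree A) \<noteq> 0"
      using A hom_eq_0[OF K(1) \<sigma>] by (simp add: coeff_hom[OF R \<sigma>] polysD)
    then have "map_poly \<sigma> A \<noteq> 0" by auto
    then show ?thesis using poly_roots_finite countable_finite by blast
  qed
  moreover have "countable (polys K - {0})" using countable_polys[OF K(2)] by (rule countable_Diff)
  ultimately show ?thesis using countable_UN[of "polys K - {0}"] by (metis (no_types, lifting))
qed

text \<open>An open condition at \<open>z\<close> persists at points \<open>s z\<close> with \<open>s\<close> slightly larger than 1, and
uncountably many such points are available to avoid a countable set.\<close>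

lemma generic_point_on_ray:
  fixes N D :: "complex poly"
  assumes "countable X" and "z \<noteq> 0" and "poly D z \<noteq> 0" and "\<theta> < cmod (poly N z / poly D z)"
  shows "\<exists>b. b \<notin> X \<and> cmod z \<le> cmod b \<and> cmod b \<le> 2 * cmod z \<and> \<theta> < cmod (poly N b / poly D b)"
proof -
  have "isCont (\<lambda>s. cmod (poly N (of_real s * z) / poly D (of_real s * z))) 1"
    using assms(3) by (intro continuous_intros) auto
  then have "((\<lambda>s. cmod (poly N (of_real s * z) / poly D (of_real s * z))) \<longlongrightarrow> cmod (poly N z / poly D z)) (at_right 1)"
    by (auto simp: isCont_def intro: tendsto_within_subset)
  then have "\<forall>\<^sub>F s in at_right 1. \<theta> < cmod (poly N (of_real s * z) / poly D (of_real s * z))"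
    using assms(4) by (rule order_tendstoD)
  then obtain e where e: "e > 1" 
    "\<And>s. s > 1 \<Longrightarrow> s < e \<Longrightarrow> \<theta> < cmod (poly N (of_real s * z) / poly D (of_real s * z))"
    unfolding eventually_at_right_field by blast
  define m where "m = min e 2"
  have m: "1 < m" "m \<le> e" "m \<le> 2" using e(1) by (auto simp: m_def)
  have "inj_on (\<lambda>s. of_real s * z) {1<..<m}" using assms(2) by (auto simp: inj_on_def)
  then have "uncountable ((\<lambda>s. of_real s * z) ` {1<..<m})"
    using countable_image_inj_on uncountable_open_interval m(1) by blast
  then have "\<not> (\<lambda>s. of_real s * z) ` {1<..<m} \<subseteq> X" using assms(1) countable_subset by blast
  then obtain s where s: "s \<in> {1<..<m}" "of_real s * z \<notin> X" by blast
  define b where "b = of_real s * z"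
  have sb: "1 < s" "s < e" "s < 2" using s m by auto
  have "cmod b = s * cmod z" using sb by (simp add: b_def norm_mult)
  moreover have "cmod z \<le> s * cmod z" "s * cmod z \<le> 2 * cmod z" using sb assms(2) by auto
  ultimately show ?thesis using e(2)[OF sb(1,2)] s(2) by (intro exI[of _ b]) (auto simp: b_def)
qed

lemma transcendental_poly_eq_0:
  assumes K: "is_subfield K" and t: "t \<notin> icl K" and E: "E \<in> polys K" "poly E t = 0"
  shows "E = 0"
proof (rule ccontr)
  note R = subfield_subring[OF K]
  assume "E \<noteq> 0"
  define E' where "E' = Polynomial.smult (inverse (lead_coeff E)) E"
  have "E' \<in> polys K" unfolding E'_def using E by (intro smult_polys R subfield_inverse K polysD)
  moreover have "lead_coeff E' = 1" "poly E' t = 0" using \<open>E \<noteq> 0\<close> E by (auto simp: E'_def)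
  ultimately show False using t by (auto simp: icl_def)
qed

text \<open>Replacing the transcendental \<open>t\<close> by an integral number \<open>z\<close> preserves integrality: a monic equation
for \<open>A(t)/Q(t)\<close> becomes a polynomial identity after multiplication by a power of the denominator, and this
identity can be evaluated at \<open>z\<close>.\<close>

lemma specialize_integral:
  assumes K: "is_subfield K" and t: "t \<notin> icl K" and B: "is_subring B" "B \<subseteq> K"
    and A: "A \<in> polys K" and Q: "Q \<in> polys K" "poly Q t \<noteq> 0"
    and u: "poly A t / poly Q t \<in> icl ((\<lambda>E. poly E t) ` polys B)"
    and z: "z \<in> icl B" "poly Q z \<noteq> 0"
  shows "poly A z / poly Q z \<in> icl B"
proof -
  note R = subfield_subring[OF K]
  note P = subring_polys[OF R]
  obtain W where W: "W \<in> polys ((\<lambda>E. poly E t) ` polys B)" "lead_coeff W = 1" 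
    "poly W (poly A t / poly Q t) = 0" using u by (auto simp: icl_def)
  define n where "n = degree W"
  have "\<forall>i. \<exists>E\<in>polys B. coeff W i = poly E t" using W(1) by (auto simp: polys_def)
  then obtain E where E: "\<And>i. E i \<in> polys B" "\<And>i. coeff W i = poly (E i) t" by metis
  have EK: "E i \<in> polys K" for i using E(1) polys_mono[OF B(2)] by blast
  have "E n - 1 \<in> polys K" by (intro subring_diff P EK subring_1)
  moreover have "poly (E n - 1) t = 0" using E(2)[of n] W(2) unfolding n_def by simp
  ultimately have En: "E n = 1" using transcendental_poly_eq_0[OF K t] by fastforce
  define H where "H = (\<Sum>i\<le>n. E i * A ^ i * Q ^ (n - i))"
  have HK: "H \<in> polys K" unfolding H_def
    by (intro subring_sum subring_mult subring_power P EK A Q)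
  have Hv: "poly H v = poly Q v ^ n * (\<Sum>i\<le>n. poly (E i) v * (poly A v / poly Q v) ^ i)" if "poly Q v \<noteq> 0" for v
  proof -
    have eq: "poly (E i) v * poly A v ^ i * poly Q v ^ (n - i) = poly Q v ^ n * (poly (E i) v * (poly A v / poly Q v) ^ i)"
      if "i \<le> n" for i
    proof -
      have qn: "poly Q v ^ n = poly Q v ^ (n - i) * poly Q v ^ i" using that by (simp flip: power_add)
      define r where "r = poly A v / poly Q v"
      have "poly A v = r * poly Q v" using \<open>poly Q v \<noteq> 0\<close> by (simp add: r_def)
      then have "poly (E i) v * poly A v ^ i * poly Q v ^ (n - i) = poly (E i) v * r ^ i * (poly Q v ^ (n - i) * poly Q v ^ i)"
        by (simp only: power_mult_distrib mult_ac)
      then show ?thesis unfolding qn[symmetric] r_def by (simp only: mult_ac)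
    qed
    show ?thesis unfolding H_def poly_sum poly_mult poly_power sum_distrib_left
      by (rule sum.cong[OF refl], rule eq, rule iffD1[OF atMost_iff])
  qed
  have "poly W (poly A t / poly Q t) = (\<Sum>i\<le>n. poly (E i) t * (poly A t / poly Q t) ^ i)"
    unfolding poly_altdef[of W] n_def E(2) ..
  then have "poly H t = 0" unfolding Hv[OF Q(2)] W(3) by simp
  then have "H = 0" by (rule transcendental_poly_eq_0[OF K t HK])
  then have "poly H z = 0" by simp
  then have prod0: "poly Q z ^ n * (\<Sum>i\<le>n. poly (E i) z * (poly A z / poly Q z) ^ i) = 0"
    unfolding Hv[OF z(2)] .
  have "poly Q z ^ n \<noteq> 0" using z(2) by simp
  with iffD1[OF mult_eq_0_iff prod0]
  have 0: "(\<Sum>i\<le>n. poly (E i) z * (poly A z / poly Q z) ^ i) = 0" by blast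
  define V where "V = (\<Sum>i\<le>n. monom (poly (E i) z) i)"
  note I = subring_icl[OF B(1)]
  have "poly (E i) z \<in> icl B" for i
    using poly_polys[OF I _ z(1)] polys_mono[OF icl_base[OF B(1)]] E(1) by blast
  then have "V \<in> polys (icl B)" unfolding V_def
    by (intro subring_sum subring_polys I monom_polys)
  moreover have cV: "coeff V i = (if i \<le> n then poly (E i) z else 0)" for i
    by (simp add: V_def coeff_sum)
  have "degree V = n"
    by (rule antisym[OF degree_le le_degree]) (auto simp: cV En)
  then have "lead_coeff V = 1" by (simp add: cV En)
  moreover have "poly V (poly A z / poly Q z) = 0" using 0 by (simp add: V_def poly_sum poly_monom)
  ultimately show ?thesis by (rule icl_root[OF B(1)])
qed

lemma common_monic_denominator:
  assumes K: "is_subfield K" and F: "finite F" "F \<subseteq> adj K t"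
  shows "\<exists>q\<in>polys K. lead_coeff q = 1 \<and> poly q t \<noteq> 0 \<and> (\<forall>x\<in>F. \<exists>A\<in>polys K. x = poly A t / poly q t)"
proof -
  note R = subfield_subring[OF K]
  obtain q where q: "q \<in> polys K" "poly q t \<noteq> 0" "\<forall>x\<in>F. \<exists>A\<in>polys K. x = poly A t / poly q t"
    using common_denominator[OF K F] by blast
  define c where "c = inverse (lead_coeff q)"
  have c: "c \<in> K" "c \<noteq> 0" using q(1,2) by (auto simp: c_def intro!: subfield_inverse K polysD)
  have "\<exists>A\<in>polys K. x = poly A t / poly (Polynomial.smult c q) t" if x: "x \<in> F" for x
  proof -
    obtain A where "A \<in> polys K" "x = poly A t / poly q t" using bspec[OF q(3) x] by (elim bexE)
    then have "x = poly (Polynomial.smult c A) t / poly (Polynomial.smult c q) t" 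
      and "Polynomial.smult c A \<in> polys K" using c by (auto intro!: smult_polys R)
    then show ?thesis by blast
  qed
  moreover have "lead_coeff (Polynomial.smult c q) = 1" using c q(2) by (auto simp: c_def)
  ultimately show ?thesis using c q(1,2) by (intro bexI[of _ "Polynomial.smult c q"] smult_polys R) auto
qed

text \<open>Write the elements of \<open>F\<close> with a common monic denominator \<open>q(t)\<close> and control the coefficients
that occur, by \<open>p'\<close> and \<open>M\<close>. On a circle of large integral radius \<open>\<rho>\<close> every conjugate of \<open>q\<close> is bounded below,
because \<open>q\<close> is monic with coefficients bounded by \<open>M\<close>. To make a given integral \<open>u = A(t)/Q(t)\<close> large, specialize
\<open>t\<close> to \<open>\<rho>\<close> times a root of unity avoiding the zeros of \<open>A\<close> and \<open>Q\<close>. The value \<open>w\<close> is a nonzero integral element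
of an algebraic extension of \<open>K\<close>, so some homomorphism \<open>\<sigma>\<close> makes it large; the image of the root of unity is again
a root of unity, so the image of \<open>t\<close> stays on the circle. Moving this image slightly outward to a
transcendental position gives a homomorphism of the original field. Roots of unity are essential here: they
supply infinitely many points of bounded modulus all of whose conjugates are bounded as well.\<close>

lemma controllable_adj_transcendental:
  assumes c: "controllable K" and t: "t \<notin> icl K"
  shows "controllable (adj K t)"
proof -
  have K: "is_subfield K" "countable K" using c by (auto simp: controllable_def)
  note R = subfield_subring[OF K(1)]
  note P = subring_polys[OF R]
  have "\<exists>p M. controlled (adj K t) F p M" if F: "finite F" "F \<subseteq> adj K t" for F
  proof -
    obtain q where q: "q \<in> polys K" "lead_coeff q = 1" "poly q t \<noteq> 0" 
      and "\<forall>x\<in>F. \<exists>A\<in>polys K. x = poly A t / poly q t"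
      using common_monic_denominator[OF K(1) F] by blast
    then obtain N where N: "\<And>x. x \<in> F \<Longrightarrow> N x \<in> polys K" "\<And>x. x \<in> F \<Longrightarrow> x = poly (N x) t / poly q t"
      by metis
    define F' where "F' = range (coeff q) \<union> (\<Union>x\<in>F. range (coeff (N x)))"
    have "finite F'" unfolding F'_def using F finite_range_coeff by blast
    moreover have "F' \<subseteq> K" using q N(1) by (auto simp: F'_def polys_def)
    ultimately obtain p' M where ctrl: "controlled K F' p' M" using c by (auto simp: controllable_def)
    note D = controlledD[OF ctrl]
    define B where "B = scaled_ring p' F'"
    have B: "is_subring B" unfolding B_def by (rule subring_scaled_ring)
    have BK: "B \<subseteq> K" unfolding B_def using D by (intro scaled_ring_least R) (auto intro: subring_mult R)
    have BF: "Polynomial.smult p' A \<in> polys B" if "range (coeff A) \<subseteq> F'" for A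
      using that by (auto simp: polys_def B_def intro: scaled_ring_F)
    define p where "p = p' * poly q t"
    have p: "p \<noteq> 0" "p \<in> adj K t" using D(4,5) q poly_adj[OF R q(1), of t] subset_adj[OF R, of t]
      by (auto simp: p_def intro!: subring_mult subfield_subring subfield_adj K)
    \<comment> \<open>The ring \<open>B[t]\<close>, which contains the scaled ring of the extension.\<close>
    define T where "T = (\<lambda>E. poly E t) ` polys B"
    have T: "is_subring T" 
      unfolding is_subring_def T_def
    proof (intro conjI ballI)
      show "1 \<in> (\<lambda>E. poly E t) ` polys B" 
        by (rule image_eqI[of _ _ 1]) (auto intro: subring_1 subring_polys B)
      fix x y assume "x \<in> (\<lambda>E. poly E t) ` polys B" "y \<in> (\<lambda>E. poly E t) ` polys B"
      then obtain X Y where XY: "X \<in> polys B" "Y \<in> polys B" "x = poly X t" "y = poly Y t" by auto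
      then show "x - y \<in> (\<lambda>E. poly E t) ` polys B" "x * y \<in> (\<lambda>E. poly E t) ` polys B"
        using image_eqI[of "x - y" "\<lambda>E. poly E t" "X - Y"] image_eqI[of "x * y" "\<lambda>E. poly E t" "X * Y"]
        by (auto intro: subring_diff subring_mult subring_polys B)
    qed
    have "scaled_ring p F \<subseteq> T"
    proof (intro scaled_ring_least T)
      show "p \<in> T" unfolding T_def p_def
        by (rule image_eqI[of _ _ "Polynomial.smult p' q"]) (auto intro!: BF simp: F'_def)
      fix x assume x: "x \<in> F"
      have "x * poly q t = poly (N x) t" by (rule iffD1[OF nonzero_eq_divide_eq[OF q(3)] N(2)[OF x]])
      then have "p * x = p' * poly (N x) t" unfolding p_def by (metis mult.assoc mult.commute)
      moreover have "range (coeff (N x)) \<subseteq> F'" unfolding F'_def using x by blast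
      ultimately show "p * x \<in> T" unfolding T_def
        by (intro image_eqI[of _ _ "Polynomial.smult p' (N x)"] BF) simp_all
    qed
    then have sub: "icl (scaled_ring p F) \<subseteq> icl T" by (rule icl_mono)
    \<comment> \<open>An integer, so that \<open>\<rho>\<close> times a root of unity is integral, and beyond the roots of all conjugates of \<open>q\<close>.\<close>
    define \<rho> :: nat where "\<rho> = nat \<lceil>1 + of_nat (degree q) * M\<rceil>"
    have "0 \<le> of_nat (degree q) * M" using D(6) by simp
    then have \<rho>: "1 + of_nat (degree q) * M \<le> of_nat \<rho>" "1 \<le> real \<rho>" unfolding \<rho>_def by linarith+
    define d where "d = degree q + (\<Sum>x\<in>F. degree (N x))"
    \<comment> \<open>A bound for the conjugated numerators and for \<open>q\<close> on the disc of radius \<open>2 \<rho>\<close>.\<close>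
    define M1 where "M1 = (\<Sum>i\<le>d. M * (2 * real \<rho>) ^ i)"
    define M' where "M' = M1 + M * M1"
    have M1: "0 \<le> M1" unfolding M1_def using D(6) by (intro sum_nonneg) auto
    have "\<exists>\<tau>. hom_on (adj K t) \<tau> \<and> \<theta> < cmod (\<tau> u) \<and> (\<forall>x\<in>insert p F. cmod (\<tau> x) \<le> M')"
      if u: "u \<in> adj K t" "u \<noteq> 0" "u \<in> icl (scaled_ring p F)" "\<theta> < 1" for u \<theta>
    proof -
      obtain A Q where AQ: "A \<in> polys K" "Q \<in> polys K" "poly Q t \<noteq> 0" "u = poly A t / poly Q t"
        using u(1) by (rule adjE)
      have "A * Q \<noteq> 0" using AQ u(2) by auto
      then obtain \<zeta> n where \<zeta>: "n > 0" "\<zeta> ^ n = 1" "poly (A * Q) (of_nat \<rho> * \<zeta>) \<noteq> 0"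
        using root_of_unity_avoiding[of "A * Q" "of_nat \<rho>"] \<rho>(2) by auto
      define z where "z = of_nat \<rho> * \<zeta>"
      have zAQ: "poly A z \<noteq> 0" "poly Q z \<noteq> 0" using \<zeta>(3) by (auto simp: z_def)
      have \<zeta>i: "\<zeta> \<in> icl S" if S: "is_subring S" for S :: "complex set"
      proof -
        have "monom 1 n - 1 \<in> polys S" by (intro subring_diff subring_polys S monom_polys subring_1)
        moreover have "degree (monom 1 n - 1 :: complex poly) = n" 
          by (rule antisym[OF degree_diff_le le_degree]) (use \<zeta>(1) in \<open>auto simp: degree_monom_eq\<close>)
        then have "lead_coeff (monom 1 n - 1 :: complex poly) = 1" using \<zeta>(1) by simp
        moreover have "poly (monom 1 n - 1) \<zeta> = 0" using \<zeta>(2) by (simp add: poly_monom)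
        ultimately show ?thesis unfolding icl_def by blast
      qed
      have zi: "z \<in> icl B" unfolding z_def using \<zeta>i[OF B]
        by (intro subring_mult subring_icl B subring_of_nat)
      define w where "w = poly A z / poly Q z"
      have w: "w \<in> icl B" unfolding w_def
        using u(3) sub AQ(4) unfolding T_def
        by (intro specialize_integral[OF K(1) t B BK AQ(1-3) _ zi zAQ(2)]) auto
      define L where "L = adj K \<zeta>"
      have L: "is_subfield L" "K \<subseteq> L" "\<zeta> \<in> L"
        unfolding L_def using subfield_adj K subset_adj[OF R] in_adj[OF R] by auto
      note RL = subfield_subring[OF L(1)]
      have zL: "z \<in> L" unfolding z_def by (intro subring_mult subring_of_nat RL L)
      have PL: "polys K \<subseteq> polys L" by (rule polys_mono[OF L(2)])
      have wL: "w \<in> L" unfolding w_def using zL PL AQ by (intro subfield_divide poly_polys RL L(1)) auto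
      have "w \<noteq> 0" using zAQ by (simp add: w_def)
      then obtain \<sigma> where \<sigma>: "hom_on L \<sigma>" "\<theta> < cmod (\<sigma> w)" "\<forall>x\<in>insert p' F'. cmod (\<sigma> x) \<le> M"
        using controlledD(7)[OF controlled_adj_algebraic[OF ctrl \<zeta>i[OF R]], folded L_def, OF wL u(4)] w
        unfolding B_def by blast
      have \<sigma>K: "hom_on K \<sigma>" using hom_on_subset[OF \<sigma>(1) L(2)] .
      have "\<sigma> \<zeta> ^ n = 1" using hom_power[OF RL \<sigma>(1) L(3), of n] \<zeta>(2) hom_1[OF RL \<sigma>(1)] by simp
      then have "cmod (\<sigma> \<zeta>) ^ n = 1" by (metis norm_one norm_power)
      then have n1: "cmod (\<sigma> \<zeta>) = 1" using \<zeta>(1) 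
        by (intro power_eq_imp_eq_base[of "cmod (\<sigma> \<zeta>)" n 1]) auto
      have \<sigma>nat: "\<sigma> (of_nat k) = of_nat k" for k
        by (induction k) (simp_all add: hom_0[OF RL \<sigma>(1)] hom_1[OF RL \<sigma>(1)] hom_add[OF RL \<sigma>(1)] subring_1 subring_of_nat RL)
      have "\<sigma> z = of_nat \<rho> * \<sigma> \<zeta>"
        unfolding z_def using hom_mult[OF RL \<sigma>(1) subring_of_nat[OF RL] L(3)] \<sigma>nat by simp
      then have nz: "cmod (\<sigma> z) = \<rho>" using n1 by (simp add: norm_mult)
      have \<sigma>ev: "\<sigma> (poly E z) = poly (map_poly \<sigma> E) (\<sigma> z)" if "E \<in> polys K" for E
        using poly_map_hom[OF RL \<sigma>(1) _ zL] that PL by auto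
      have \<sigma>w: "\<sigma> w = poly (map_poly \<sigma> A) (\<sigma> z) / poly (map_poly \<sigma> Q) (\<sigma> z)"
        unfolding w_def using hom_divide[OF L(1) \<sigma>(1), of "poly A z" "poly Q z"] \<sigma>ev AQ PL zL
        by (auto intro!: poly_polys RL)
      have Qz: "poly (map_poly \<sigma> Q) (\<sigma> z) \<noteq> 0"
        using \<sigma>ev[OF AQ(2)] hom_eq_0[OF L(1) \<sigma>(1), of "poly Q z"] zAQ poly_polys[OF RL _ zL] AQ(2) PL by auto
      have \<sigma>z: "\<sigma> z \<noteq> 0" using nz \<rho> by auto
      then obtain b where b: "b \<notin> {b. \<exists>A\<in>polys K. A \<noteq> 0 \<and> poly (map_poly \<sigma> A) b = 0}"
        "real \<rho> \<le> cmod b" "cmod b \<le> 2 * real \<rho>" 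
        "\<theta> < cmod (poly (map_poly \<sigma> A) b / poly (map_poly \<sigma> Q) b)"
        using generic_point_on_ray[OF countable_hom_image_icl[OF K \<sigma>K] \<sigma>z Qz \<sigma>(2)[unfolded \<sigma>w], unfolded nz]
        by (elim exE conjE)
      have same: "poly (map_poly \<sigma> E) b = 0 \<longleftrightarrow> poly E t = 0" if "E \<in> polys K" for E
        using b(1) transcendental_poly_eq_0[OF K(1) t that] that by auto
      obtain \<tau> where \<tau>: "hom_on (adj K t) \<tau>" "\<forall>x\<in>K. \<tau> x = \<sigma> x" 
        "\<And>A Q. A \<in> polys K \<Longrightarrow> Q \<in> polys K \<Longrightarrow> poly Q t \<noteq> 0 \<Longrightarrow>
          \<tau> (poly A t / poly Q t) = poly (map_poly \<sigma> A) b / poly (map_poly \<sigma> Q) b"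
        using hom_extend[OF K(1) \<sigma>K same] by blast
      have cb: "cmod (coeff (map_poly \<sigma> E) i) \<le> M" if "range (coeff E) \<subseteq> F'" for E i
        using \<sigma>(3) that by (auto simp: coeff_hom[OF R \<sigma>K])
      have bound: "cmod (poly (map_poly \<sigma> E) b) \<le> M1" if "range (coeff E) \<subseteq> F'" "degree E \<le> d" for E
        unfolding M1_def by (rule poly_norm_bound[OF cb[OF that(1)] order_trans[OF degree_map_poly_le that(2)] b(3)])
      have qb: "1 \<le> cmod (poly (map_poly \<sigma> q) b)"
      proof (cases "degree q = 0")
        case True
        then obtain e where "q = [:e:]" using degree_eq_zeroE by blast
        then have "q = 1" using q(2) by (simp add: one_pCons)
        then show ?thesis using map_poly_hom_1[OF R \<sigma>K] by simp
      next
        case False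
        have dq: "degree (map_poly \<sigma> q) = degree q" by (rule degree_map_hom[OF R \<sigma>K q(2)])
        have "cmod b ^ (degree (map_poly \<sigma> q) - 1) * (1 + 0) \<le> cmod (poly (map_poly \<sigma> q) b)"
          using b(2) \<rho> False 
          by (intro monic_poly_large[OF lead_coeff_map_hom[OF R \<sigma>K q(2)] cb]) (auto simp: F'_def dq)
        moreover have "1 \<le> cmod b ^ (degree (map_poly \<sigma> q) - 1)" using b(2) \<rho> by (intro one_le_power) linarith
        ultimately show ?thesis by (metis add_0_right mult_1_right order_trans)
      qed
      have "cmod (\<tau> x) \<le> M'" if x: "x \<in> insert p F" for x
      proof (cases "x \<in> F")
        case True
        have "\<tau> x = poly (map_poly \<sigma> (N x)) b / poly (map_poly \<sigma> q) b"
          by (subst N(2)[OF True]) (rule \<tau>(3)[OF N(1)[OF True] q(1,3)])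
        then have "cmod (\<tau> x) = cmod (poly (map_poly \<sigma> (N x)) b) / cmod (poly (map_poly \<sigma> q) b)"
          by (simp add: norm_divide)
        also have "\<dots> \<le> cmod (poly (map_poly \<sigma> (N x)) b) / 1" using qb by (intro divide_left_mono) auto
        also have "\<dots> \<le> M1" 
          using bound[of "N x"] True member_le_sum[of x F "\<lambda>x. degree (N x)"] F by (auto simp: F'_def d_def)
        finally show ?thesis using mult_nonneg_nonneg[OF D(6) M1] by (simp add: M'_def)
      next
        case False
        then have "x = poly (Polynomial.smult p' q) t / poly 1 t" using x by (simp add: p_def)
        then have "\<tau> x = poly (map_poly \<sigma> (Polynomial.smult p' q)) b / poly (map_poly \<sigma> 1) b"
          using \<tau>(3)[OF smult_polys[OF R D(4) q(1)] subring_1[OF P]] by simp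
        also have "map_poly \<sigma> (Polynomial.smult p' q) = Polynomial.smult (\<sigma> p') (map_poly \<sigma> q)"
          using q(1) D(4) by (intro poly_eqI) (auto simp: coeff_hom[OF R \<sigma>K] hom_mult[OF R \<sigma>K] polysD)
        finally have "cmod (\<tau> x) = cmod (\<sigma> p') * cmod (poly (map_poly \<sigma> q) b)"
          using map_poly_hom_1[OF R \<sigma>K] by (simp add: norm_mult)
        also have "\<dots> \<le> M * M1" using \<sigma>(3) bound[of q] M1 D(6) by (intro mult_mono) (auto simp: F'_def d_def)
        finally show ?thesis using M1 by (simp add: M'_def)
      qed
      moreover have "\<theta> < cmod (\<tau> u)" using \<tau>(3)[OF AQ(1-3)] AQ(4) b(4) by simp
      ultimately show ?thesis using \<tau>(1) by blast
    qed
    then have "controlled (adj K t) F p M'" unfolding controlled_def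
      using p F subfield_adj[OF K(1)] countable_adj[OF K(2)] by blast
    then show ?thesis by blast
  qed
  then show ?thesis using K subfield_adj countable_adj by (auto simp: controllable_def)
qed

lemma exists_controllable:
  assumes "finite F"
  shows "\<exists>K. controllable K \<and> F \<subseteq> K"
  using assms
proof (induction F)
  case empty
  show ?case using controllable_Rats by blast
next
  case (insert a F)
  then obtain K where K: "controllable K" "F \<subseteq> K" by blast
  then have "is_subring K" by (simp add: controllable_def subfield_subring)
  then have "insert a F \<subseteq> adj K a" using subset_adj[of K a] in_adj[of K a] K(2) by blast
  moreover have "controllable (adj K a)"
    using controllable_adj_algebraic controllable_adj_transcendental K(1) by blast
  ultimately show ?case by blast
qed

section \<open>Denominators of preperiodic points\<close>

lemma rescale_mult: "rescale p (D + E) (P * Q) = rescale p D P * rescale p E Q"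
  by (simp add: rescale_def pcompose_mult power_add mult_ac)

lemma rescale_raise: "D \<le> E \<Longrightarrow> rescale p E P = Polynomial.smult (p ^ (E - D)) (rescale p D P)"
  by (simp add: rescale_def flip: power_add)

text \<open>Horner's rule: each step multiplies by \<open>Q\<close> and adds a coefficient of \<open>f\<close>. That coefficient
lies in \<open>B\<close> after multiplication by \<open>p ^ D\<close>, hence also after multiplication by \<open>p ^ (D * e)\<close>.\<close>

lemma rescale_pcompose:
  fixes p :: "'a :: field"
  assumes B: "is_subring B" "p \<in> B" and Q: "rescale p e Q \<in> polys B" and e: "e \<ge> 1"
  shows "degree f \<le> D \<Longrightarrow> (\<And>i. i \<le> D \<Longrightarrow> p ^ (D - i) * coeff f i \<in> B) \<Longrightarrow>
    rescale p (D * e) (pcompose f Q) \<in> polys B"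
proof (induction f arbitrary: D)
  case 0
  then show ?case by (simp add: rescale_def subring_0 subring_polys B)
next
  case (pCons a f)
  note P = subring_polys[OF B(1)]
  have "p ^ (D * e) * a = p ^ (D * (e - 1)) * (p ^ D * a)"
    using e by (simp flip: power_add mult.assoc add: algebra_simps)
  also have "\<dots> \<in> B" 
    by (rule subring_mult[OF B(1) subring_power[OF B]]) (use pCons.prems(2)[of 0] in simp)
  finally have 1: "rescale p (D * e) [:a:] \<in> polys B"
    by (auto simp: rescale_def intro!: pCons_polys subring_0 P B)
  show ?case
  proof (cases "f = 0")
    case True
    then show ?thesis using 1 by simp
  next
    case False
    then obtain D' where D': "D = Suc D'" using pCons.prems(1) by (cases D) auto
    have "rescale p (D' * e) (pcompose f Q) \<in> polys B"
    proof (rule pCons.IH)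
      show "degree f \<le> D'" using pCons.prems(1) False D' by simp
      show "p ^ (D' - i) * coeff f i \<in> B" if "i \<le> D'" for i
        using pCons.prems(2)[of "Suc i"] that D' by simp
    qed
    then have "rescale p (e + D' * e) (Q * pcompose f Q) \<in> polys B"
      unfolding rescale_mult by (intro subring_mult P Q)
    moreover have "rescale p (D * e) (pcompose (pCons a f) Q) 
        = rescale p (D * e) [:a:] + rescale p (D * e) (Q * pcompose f Q)"
      by (simp add: rescale_def pcompose_pCons pcompose_add smult_add_right)
    ultimately show ?thesis using subring_add[OF P 1] by (simp add: D')
  qed
qed

definition iter_poly :: "'a :: comm_semiring_0 poly \<Rightarrow> 'a poly \<Rightarrow> nat \<Rightarrow> 'a poly" where
  "iter_poly f g n = (pcompose f ^^ n) g"

lemma iter_poly_simps: "iter_poly f g 0 = g" "iter_poly f g (Suc n) = pcompose f (iter_poly f g n)"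
  by (simp_all add: iter_poly_def)

lemma poly_iter_poly: "poly (iter_poly f g n) x = (poly f ^^ n) (poly g x)"
  by (induction n) (simp_all add: iter_poly_simps poly_pcompose)

lemma degree_iter_poly: "degree (iter_poly f g n) = degree f ^ n * degree (g :: 'a :: field poly)"
  by (induction n) (simp_all add: iter_poly_simps degree_pcompose)

lemma monic_iter_poly:
  assumes "lead_coeff f = 1" "degree f \<ge> 1" "lead_coeff g = 1" "degree g \<ge> 1"
  shows "lead_coeff (iter_poly f (g :: 'a :: field poly) n) = 1"
proof (induction n)
  case (Suc n)
  have "degree (iter_poly f g n) > 0" using assms by (simp add: degree_iter_poly)
  from lead_coeff_comp[OF this, of f] show ?case unfolding Suc assms(1) iter_poly_simps by simp
qed (simp add: iter_poly_simps assms)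

lemma preperiodicE:
  assumes "preperiodic f y"
  obtains i j where "j < i" "(poly f ^^ i) y = (poly f ^^ j) y"
proof -
  obtain i j where "i \<noteq> j" "(poly f ^^ i) y = (poly f ^^ j) y" 
    using assms by (auto simp: preperiodic_def)
  then show ?thesis using that[of i j] that[of j i] by (cases "j < i") auto
qed

lemma preperiodic_funpow: "preperiodic f y \<Longrightarrow> preperiodic f ((poly f ^^ n) y)"
proof -
  assume "preperiodic f y"
  then obtain i j where ij: "j < i" "(poly f ^^ i) y = (poly f ^^ j) y" by (rule preperiodicE)
  have swap: "(poly f ^^ k) ((poly f ^^ n) y) = (poly f ^^ n) ((poly f ^^ k) y)" for k
    using fun_cong[OF funpow_add[of k n "poly f"], of y] fun_cong[OF funpow_add[of n k "poly f"], of y]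
    by (simp add: add.commute)
  show ?thesis unfolding preperiodic_def by (intro exI[of _ i] exI[of _ j]) (use ij in \<open>simp add: swap\<close>)
qed

text \<open>The equation \<open>f\<^sup>i(g(x)) = f\<^sup>j(g(x))\<close> with \<open>j < i\<close> is monic in \<open>x\<close>, because the degree of the left
hand side is strictly larger. Its coefficients have denominators that grow with the degree, but
only in the weighted sense of \<open>rescale\<close>, so that a single factor \<open>p\<close> makes the root integral.\<close>

lemma preperiodic_integral:
  fixes f g :: "complex poly"
  assumes B: "is_subring B" "p \<in> B" and p: "p \<noteq> 0"
    and f: "degree f \<ge> 2" "lead_coeff f = 1" "\<And>i. p * coeff f i \<in> B"
    and g: "degree g \<ge> 1" "lead_coeff g = 1" "\<And>i. p * coeff g i \<in> B"
    and pre: "preperiodic f (poly g x)"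
  shows "p * x \<in> icl B"
proof -
  define e where "e = degree g"
  define d where "d = degree f"
  have int: "rescale p (d ^ n * e) (iter_poly f g n) \<in> polys B" for n
  proof (induction n)
    case 0
    show ?case using monic_rescale_polys[OF B p g(2,3)] by (simp add: iter_poly_simps e_def)
  next
    case (Suc n)
    have "rescale p (d * (d ^ n * e)) (pcompose f (iter_poly f g n)) \<in> polys B"
    proof (rule rescale_pcompose[OF B Suc])
      show "1 \<le> d ^ n * e" using f(1) g(1) by (simp add: d_def e_def)
      show "p ^ (d - i) * coeff f i \<in> B" if "i \<le> d" for i
        using monic_weighted_coeff[OF B f(2,3)] that by (simp add: d_def)
    qed (simp add: d_def)
    then show ?case by (simp add: iter_poly_simps mult.assoc)
  qed
  obtain i j where ij: "j < i" "(poly f ^^ i) (poly g x) = (poly f ^^ j) (poly g x)"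
    using pre by (rule preperiodicE)
  define P where "P = iter_poly f g i - iter_poly f g j"
  have lt: "d ^ j * e < d ^ i * e" using ij(1) f(1) g(1) by (simp add: d_def e_def power_strict_increasing)
  have dF: "degree (iter_poly f g n) = d ^ n * e" for n by (simp add: degree_iter_poly d_def e_def)
  have lF: "coeff (iter_poly f g n) (d ^ n * e) = 1" for n
    using monic_iter_poly[OF f(2) _ g(2,1), of n] f(1) by (simp add: dF)
  have cP: "coeff P (d ^ i * e) = 1" using lt by (simp add: P_def lF coeff_eq_0 dF)
  have dP: "degree P = d ^ i * e"
    by (rule antisym[OF _ le_degree]) (use lt cP in \<open>auto simp: P_def dF intro!: degree_diff_le\<close>)
  have "rescale p (degree P) P = rescale p (d ^ i * e) (iter_poly f g i) - rescale p (d ^ i * e) (iter_poly f g j)"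
    by (simp add: dP) (simp add: P_def rescale_def pcompose_diff smult_diff_right)
  also have "\<dots> \<in> polys B" 
    unfolding rescale_raise[OF less_imp_le[OF lt], of p "iter_poly f g j"]
    by (intro subring_diff subring_polys B int smult_polys subring_power)
  finally show ?thesis
    using cP ij(2) by (intro icl_rescale_root[OF p, of P]) (simp_all add: dP, simp add: P_def poly_iter_poly)
qed

text \<open>The point \<open>f\<^sup>n(g(x))\<close> is preperiodic too, so the previous lemma applies to it with the identity in
place of \<open>g\<close>. The power of \<open>p\<close> does not depend on \<open>n\<close>; this makes the denominators of the determinant below
cheap.\<close>

lemma preperiodic_integral_orbit:
  fixes f g :: "complex poly"
  assumes B: "is_subring B" "p \<in> B" and p: "p \<noteq> 0"
    and f: "degree f \<ge> 2" "lead_coeff f = 1" "\<And>i. p * coeff f i \<in> B"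
    and pre: "preperiodic f (poly g x)"
  shows "p * poly (iter_poly f g n) x \<in> icl B"
proof (rule preperiodic_integral[OF B p f])
  show "preperiodic f (poly [:0, 1:] (poly (iter_poly f g n) x))"
    using preperiodic_funpow[OF pre] by (simp add: poly_iter_poly)
  show "p * coeff [:0, 1:] i \<in> B" for i
    using B by (auto simp: coeff_pCons subring_0 split: nat.split)
qed auto

section \<open>Vandermonde determinants in monic bases\<close>

text \<open>The Vandermonde determinant of the points. The argument rests on two of its properties: it is nonzero
for distinct points, and it does not change when the powers are replaced by other monic polynomials.\<close>

definition power_det :: "nat \<Rightarrow> (nat \<Rightarrow> 'a :: comm_ring_1) \<Rightarrow> 'a" where
  "power_det N x = det (mat N N (\<lambda>(i, j). x j ^ i))"

lemma det_mat_leibniz: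
  "det (mat N N (\<lambda>(i, j). a i j)) = (\<Sum>\<pi> | \<pi> permutes {0..<N}. signof \<pi> * (\<Prod>i = 0..<N. a i (\<pi> i)))"
  by (subst det_def'[of _ N]) (auto intro!: sum.cong prod.cong simp: permutes_in_image)

text \<open>The change of basis matrix is unitriangular.\<close>

lemma det_monic_basis:
  fixes P :: "nat \<Rightarrow> 'a :: idom poly"
  assumes P: "\<And>i. i < N \<Longrightarrow> degree (P i) = i" "\<And>i. i < N \<Longrightarrow> lead_coeff (P i) = 1"
  shows "det (mat N N (\<lambda>(i, j). poly (P i) (x j))) = power_det N x"
proof -
  define T where "T = mat N N (\<lambda>(i, k). coeff (P i) k)"
  define A where "A = mat N N (\<lambda>(i, j). x j ^ i)"
  have car: "T \<in> carrier_mat N N" "A \<in> carrier_mat N N" by (auto simp: T_def A_def)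
  have "mat N N (\<lambda>(i, j). poly (P i) (x j)) = T * A"
  proof (rule eq_matI)
    fix i j assume "i < dim_row (T * A)" "j < dim_col (T * A)"
    then have ij: "i < N" "j < N" by (auto simp: T_def A_def)
    have "poly (P i) (x j) = (\<Sum>k = 0..<N. coeff (P i) k * x j ^ k)"
      unfolding poly_altdef P(1)[OF ij(1)] using ij P(1)[OF ij(1)]
      by (intro sum.mono_neutral_left) (auto simp: coeff_eq_0)
    then show "mat N N (\<lambda>(i, j). poly (P i) (x j)) $$ (i, j) = (T * A) $$ (i, j)"
      using ij by (simp add: T_def A_def scalar_prod_def)
  qed (auto simp: T_def A_def)
  moreover have "det T = 1"
  proof -
    have "det T = prod_list (diag_mat T)"
      by (rule det_lower_triangular[of N, OF _ car(1)]) (auto simp: T_def P(1) coeff_eq_0)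
    also have "diag_mat T = map (\<lambda>i. 1) [0..<N]"
      using P by (auto simp: diag_mat_def T_def intro!: map_cong)
    finally show ?thesis by (simp add: map_replicate_const)
  qed
  ultimately show ?thesis using det_mult[OF car] by (simp add: power_det_def A_def)
qed

text \<open>A linear dependence of the rows is a nonzero polynomial of degree less than \<open>N\<close> with \<open>N\<close> roots.\<close>

lemma power_det_nonzero:
  fixes x :: "nat \<Rightarrow> 'a :: field"
  assumes x: "inj_on x {0..<N}"
  shows "power_det N x \<noteq> 0"
proof
  define A where "A = mat N N (\<lambda>(i, j). x j ^ i)"
  have A: "A \<in> carrier_mat N N" by (simp add: A_def)
  assume "power_det N x = 0"
  then have "det (transpose_mat A) = 0" using det_transpose[OF A] by (simp add: power_det_def A_def)
  then obtain v where v: "v \<in> carrier_vec N" "v \<noteq> 0\<^sub>v N" "transpose_mat A *\<^sub>v v = 0\<^sub>v N"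
    using det_0_iff_vec_prod_zero[of "transpose_mat A" N] A by auto
  define Q where "Q = (\<Sum>i = 0..<N. monom (v $ i) i)"
  have cQ: "coeff Q i = (if i < N then v $ i else 0)" for i by (simp add: Q_def coeff_sum)
  have "Q \<noteq> 0"
  proof
    assume "Q = 0"
    then have "v $ i = 0" if "i < N" for i using cQ[of i] that by simp
    then show False using v(1,2) by (auto intro!: eq_vecI)
  qed
  have "poly Q (x j) = 0" if j: "j < N" for j
  proof -
    have "poly Q (x j) = (transpose_mat A *\<^sub>v v) $ j"
      using j v(1) by (simp add: Q_def poly_sum poly_monom A_def scalar_prod_def mult.commute)
    then show ?thesis using v(3) j by simp
  qed
  then have "x ` {0..<N} \<subseteq> {z. poly Q z = 0}" by auto
  then have "card (x ` {0..<N}) \<le> card {z. poly Q z = 0}"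
    by (intro card_mono poly_roots_finite \<open>Q \<noteq> 0\<close>)
  then have le: "N \<le> degree Q" using card_poly_roots_bound[OF \<open>Q \<noteq> 0\<close>] x by (simp add: card_image)
  then have "coeff Q (degree Q) = 0" by (simp add: cQ)
  then show False using \<open>Q \<noteq> 0\<close> by simp
qed

lemma det_norm_bound:
  fixes a :: "nat \<Rightarrow> nat \<Rightarrow> complex"
  assumes a: "\<And>i j. i < N \<Longrightarrow> j < N \<Longrightarrow> cmod (a i j) \<le> b i"
  shows "cmod (det (mat N N (\<lambda>(i, j). a i j))) \<le> fact N * (\<Prod>i = 0..<N. b i)"
proof -
  have "cmod (det (mat N N (\<lambda>(i, j). a i j))) \<le> (\<Sum>\<pi> | \<pi> permutes {0..<N}. (\<Prod>i = 0..<N. b i))"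
    unfolding det_mat_leibniz
  proof (rule sum_norm_le)
    fix \<pi> assume "\<pi> \<in> {\<pi>. \<pi> permutes {0..<N}}"
    then have \<pi>: "\<And>i. i < N \<Longrightarrow> \<pi> i < N" using permutes_in_image by fastforce
    have "cmod (signof \<pi> * (\<Prod>i = 0..<N. a i (\<pi> i))) = (\<Prod>i = 0..<N. cmod (a i (\<pi> i)))"
      by (simp add: norm_mult sign_def prod_norm)
    also have "\<dots> \<le> (\<Prod>i = 0..<N. b i)" using a \<pi> by (intro prod_mono) auto
    finally show "cmod (signof \<pi> * (\<Prod>i = 0..<N. a i (\<pi> i))) \<le> (\<Prod>i = 0..<N. b i)" .
  qed
  also have "\<dots> = fact N * (\<Prod>i = 0..<N. b i)" by (simp add: card_permutations[of "{0..<N}" N])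
  finally show ?thesis .
qed

text \<open>The factor for row \<open>i\<close> is distributed over that row; every term of the Leibniz formula contains
exactly one entry of it.\<close>

lemma scaled_det_in_subring:
  fixes p :: "'a :: comm_ring_1"
  assumes R: "is_subring R" and a: "\<And>i j. i < N \<Longrightarrow> j < N \<Longrightarrow> p ^ w i * a i j \<in> R"
  shows "p ^ (\<Sum>i = 0..<N. w i) * det (mat N N (\<lambda>(i, j). a i j)) \<in> R"
proof -
  have "p ^ (\<Sum>i = 0..<N. w i) * det (mat N N (\<lambda>(i, j). a i j)) =
    (\<Sum>\<pi> | \<pi> permutes {0..<N}. signof \<pi> * (\<Prod>i = 0..<N. p ^ w i * a i (\<pi> i)))"
    unfolding det_mat_leibniz sum_distrib_left
    by (intro sum.cong refl) (simp add: prod.distrib power_sum mult_ac)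
  also have "\<dots> \<in> R"
  proof (rule subring_sum[OF R])
    fix \<pi> assume "\<pi> \<in> {\<pi>. \<pi> permutes {0..<N}}"
    then have \<pi>: "\<pi> permutes {0..<N}" by simp
    have "p ^ w i * a i (\<pi> i) \<in> R" if "i \<in> {0..<N}" for i
      using permutes_in_image[OF \<pi>, of i] that by (intro a) auto
    then have "(\<Prod>i = 0..<N. p ^ w i * a i (\<pi> i)) \<in> R" by (rule subring_prod[OF R])
    moreover have "signof \<pi> \<in> R" using R by (simp add: sign_def subring_1 subring_uminus)
    ultimately show "signof \<pi> * (\<Prod>i = 0..<N. p ^ w i * a i (\<pi> i)) \<in> R"
      by (intro subring_mult[OF R])
  qed
  finally show ?thesis .
qed

lemma power_det_hom:
  assumes L: "is_subring L" and \<sigma>: "hom_on L \<sigma>" and x: "\<And>j. j < N \<Longrightarrow> x j \<in> L"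
  shows "\<sigma> (power_det N x) = power_det N (\<lambda>j. \<sigma> (x j))" and "power_det N x \<in> L"
proof -
  have sL: "signof \<pi> \<in> L" for \<pi> :: "nat \<Rightarrow> nat" using L by (simp add: sign_def subring_1 subring_uminus)
  have \<sigma>s: "\<sigma> (signof \<pi>) = signof \<pi>" for \<pi> :: "nat \<Rightarrow> nat"
    by (simp add: sign_def hom_1[OF L \<sigma>] hom_uminus[OF L \<sigma>] subring_1[OF L])
  have xL: "x (\<pi> i) ^ i \<in> L" if "\<pi> permutes {0..<N}" "i \<in> {0..<N}" for \<pi> i
    using that permutes_in_image[of \<pi> "{0..<N}" i] x by (intro subring_power L) auto
  have tL: "signof \<pi> * (\<Prod>i = 0..<N. x (\<pi> i) ^ i) \<in> L" if "\<pi> permutes {0..<N}" for \<pi>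
    using xL[OF that] by (intro subring_mult subring_prod L sL) auto
  show "power_det N x \<in> L" unfolding power_det_def det_mat_leibniz using tL by (intro subring_sum L) auto
  have "\<sigma> (power_det N x) = (\<Sum>\<pi> | \<pi> permutes {0..<N}. \<sigma> (signof \<pi> * (\<Prod>i = 0..<N. x (\<pi> i) ^ i)))"
    unfolding power_det_def det_mat_leibniz using tL by (intro hom_sum[OF L \<sigma>]) auto
  also have "\<dots> = (\<Sum>\<pi> | \<pi> permutes {0..<N}. signof \<pi> * (\<Prod>i = 0..<N. \<sigma> (x (\<pi> i)) ^ i))"
  proof (intro sum.cong refl)
    fix \<pi> assume "\<pi> \<in> {\<pi>. \<pi> permutes {0..<N}}"
    then have \<pi>: "\<pi> permutes {0..<N}" by simp
    have "\<sigma> (signof \<pi> * (\<Prod>i = 0..<N. x (\<pi> i) ^ i)) = signof \<pi> * \<sigma> (\<Prod>i = 0..<N. x (\<pi> i) ^ i)"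
      using xL[OF \<pi>] by (subst hom_mult[OF L \<sigma> sL]) (auto simp: \<sigma>s intro: subring_prod L)
    also have "\<sigma> (\<Prod>i = 0..<N. x (\<pi> i) ^ i) = (\<Prod>i = 0..<N. \<sigma> (x (\<pi> i) ^ i))"
      using xL[OF \<pi>] by (intro hom_prod[OF L \<sigma>]) auto
    also have "\<dots> = (\<Prod>i = 0..<N. \<sigma> (x (\<pi> i)) ^ i)"
      using \<pi> permutes_in_image[OF \<pi>] x by (intro prod.cong refl hom_power[OF L \<sigma>]) auto
    finally show "\<sigma> (signof \<pi> * (\<Prod>i = 0..<N. x (\<pi> i) ^ i)) = signof \<pi> * (\<Prod>i = 0..<N. \<sigma> (x (\<pi> i)) ^ i)" .
  qed
  finally show "\<sigma> (power_det N x) = power_det N (\<lambda>j. \<sigma> (x j))"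
    unfolding power_det_def det_mat_leibniz .
qed

text \<open>A monic basis built from \<open>h\<close> by dividing the index by \<open>degree h\<close> with remainder. Almost all of the degree is
carried by powers of \<open>h\<close>, so the size of the basis at a point is governed by the value of \<open>h\<close>.\<close>

definition digit_basis :: "'a :: comm_ring_1 poly \<Rightarrow> nat \<Rightarrow> 'a poly" where
  "digit_basis h i = h ^ (i div degree h) * [:0, 1:] ^ (i mod degree h)"

lemma digit_basis_monic:
  fixes h :: "'a :: idom poly"
  assumes h: "lead_coeff h = 1" "degree h \<ge> 1"
  shows "degree (digit_basis h i) = i" "lead_coeff (digit_basis h i) = 1"
proof -
  have "h \<noteq> 0" using h by auto
  then show "degree (digit_basis h i) = i"
    by (simp add: digit_basis_def degree_mult_eq degree_power_eq)
  show "lead_coeff (digit_basis h i) = 1"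
    unfolding digit_basis_def lead_coeff_mult lead_coeff_power h by simp
qed

lemma power_det_digit_basis:
  fixes h :: "'a :: idom poly"
  assumes "lead_coeff h = 1" "degree h \<ge> 1"
  shows "power_det N x = det (mat N N (\<lambda>(i, j). poly (digit_basis h i) (x j)))"
  using det_monic_basis[of N "digit_basis h" x] digit_basis_monic[OF assms] by simp

lemma poly_digit_basis: "poly (digit_basis h i) x = poly h x ^ (i div degree h) * x ^ (i mod degree h)"
  by (simp add: digit_basis_def)

section \<open>Estimates at common preperiodic points\<close>

text \<open>Beyond this radius the modulus increases strictly along the orbit, which therefore cannot repeat.\<close>

lemma preperiodic_bound:
  assumes f: "lead_coeff f = 1" "degree f \<ge> 2" and M: "\<And>i. cmod (coeff f i) \<le> M"
    and pre: "preperiodic f y"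
  shows "cmod y \<le> 1 + of_nat (degree f) * M"
proof (rule ccontr)
  define R where "R = 1 + of_nat (degree f) * M"
  assume "\<not> cmod y \<le> 1 + of_nat (degree f) * M"
  then have y: "R < cmod y" by (simp add: R_def)
  have M0: "0 \<le> M" using M[of 0] norm_ge_zero order_trans by blast
  then have R: "1 \<le> R" by (simp add: R_def)
  have step: "cmod z < cmod (poly f z)" if z: "R < cmod z" for z
  proof -
    have "cmod z ^ 1 * 1 < cmod z ^ 1 * (1 + (cmod z - R))" using z R by (intro mult_strict_left_mono) auto
    also have "\<dots> \<le> cmod z ^ (degree f - 1) * (1 + (cmod z - R))"
      using z R f(2) by (intro mult_right_mono power_increasing) auto
    also have "\<dots> \<le> cmod (poly f z)"
      by (rule monic_poly_large[OF f(1) M]) (use z f(2) in \<open>auto simp: R_def\<close>)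
    finally show ?thesis by simp
  qed
  define a where "a n = cmod ((poly f ^^ n) y)" for n
  have "R < a n \<and> a n < a (Suc n)" for n
  proof (induction n)
    case 0
    show ?case using y step by (simp add: a_def)
  next
    case (Suc n)
    then have "R < a (Suc n)" by linarith
    then show ?case using step[of "(poly f ^^ Suc n) y"] by (simp add: a_def)
  qed
  then have "a j < a i" if "j < i" for i j using lift_Suc_mono_less[of a] that by blast
  moreover obtain i j where "j < i" "(poly f ^^ i) y = (poly f ^^ j) y" using pre by (rule preperiodicE)
  ultimately show False by (metis a_def less_irrefl)
qed

lemma argument_bound:
  assumes g: "lead_coeff g = 1" "degree g \<ge> 1" and M: "\<And>i. cmod (coeff g i) \<le> M"
    and R: "cmod (poly g x) \<le> R"
  shows "cmod x \<le> 1 + of_nat (degree g) * (M + R)"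
proof -
  define G where "G = g - [:poly g x:]"
  have cG: "coeff G (degree g) = 1" using g by (simp add: G_def coeff_pCons split: nat.split)
  have dG: "degree G = degree g"
  proof (rule antisym[OF _ le_degree])
    show "degree G \<le> degree g" unfolding G_def by (rule degree_diff_le) auto
    show "coeff G (degree g) \<noteq> 0" using cG by simp
  qed
  have "0 \<le> R" using R norm_ge_zero order_trans by blast
  have "cmod x \<le> 1 + of_nat (degree G) * (M + R)"
  proof (rule monic_root_bound)
    show "lead_coeff G = 1" by (simp add: dG cG)
    show "poly G x = 0" by (simp add: G_def)
    show "cmod (coeff G i) \<le> M + R" for i
    proof (cases i)
      case 0
      have "cmod (coeff g 0 - poly g x) \<le> cmod (coeff g 0) + cmod (poly g x)" by (rule norm_triangle_ineq4)
      then show ?thesis using 0 M[of 0] R by (simp add: G_def)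
    next
      case (Suc k)
      then show ?thesis using M[of i] \<open>0 \<le> R\<close> by (simp add: G_def)
    qed
  qed
  then show ?thesis by (simp add: dG)
qed

text \<open>The hypothesis on the degree allows \<open>k\<close> beyond the degree as well, so that the lemma also shows that
the difference \<open>P(X + c) - P(X)\<close> has smaller degree than \<open>P\<close>.\<close>

lemma coeff_shift_diff:
  fixes P :: "'a :: field poly"
  shows "degree P \<le> Suc k \<Longrightarrow> coeff (pcompose P [:c, 1:] - P) k = of_nat (Suc k) * c * coeff P (Suc k)"
proof (induction P arbitrary: k)
  case (pCons a P)
  define D where "D = pcompose P [:c, 1:] - P"
  have eq: "pcompose (pCons a P) [:c, 1:] - pCons a P = pCons 0 D + Polynomial.smult c (D + P)"
    by (simp add: D_def pcompose_pCons algebra_simps)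
  show ?case
  proof (cases "P = 0")
    case False
    then have d: "degree P \<le> k" using pCons.prems by simp
    have 1: "coeff D k = 0" using pCons.IH[of k] d by (simp add: D_def coeff_eq_0)
    have 2: "coeff (pCons 0 D) k = of_nat k * c * coeff P k"
    proof (cases k)
      case (Suc j)
      then show ?thesis using pCons.IH[of j] d by (simp add: D_def)
    qed simp
    show ?thesis unfolding eq by (simp add: 1 2 algebra_simps del: coeff_diff)
  qed simp
qed simp

text \<open>This is the step that distinguishes two translates from one. The polynomials \<open>F = f\<^sup>n \<circ> g\<close> and
\<open>F(X + c)\<close> are monic of degree \<open>m\<close> and bounded by \<open>R\<close> at the given points. Their difference has leading coefficient
\<open>m c\<close> in degree \<open>m - 1\<close>, so the monic polynomial \<open>H\<close> obtained from it is bounded by \<open>2 R / (m |c|)\<close>, which is at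
most 1/2 for large \<open>m\<close>. In the basis made from \<open>H\<close> the entries of the Vandermonde determinant decay
exponentially with the row index. The bounds involve the coefficients only through \<open>M\<close>, so the estimate is uniform
over all conjugates.\<close>

lemma power_det_small:
  fixes f g :: "complex poly"
  defines "d \<equiv> degree f" and "e \<equiv> degree g"
  assumes f: "lead_coeff f = 1" "d \<ge> 2" "\<And>i. cmod (coeff f i) \<le> M"
    and g: "lead_coeff g = 1" "e \<ge> 1" "\<And>i. cmod (coeff g i) \<le> M"
    and c: "c \<noteq> 0" "cmod (inverse c) \<le> M"
    and pre: "\<And>j. j < N \<Longrightarrow> preperiodic f (poly g (x j))" "\<And>j. j < N \<Longrightarrow> preperiodic f (poly g (x j + c))"
    and R: "R = 1 + of_nat d * M" and S: "S = 1 + of_nat e * (M + R)"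
    and m: "m = d ^ n * e" "m \<ge> 2" "4 * R * M \<le> of_nat m"
  shows "cmod (power_det N x) \<le> fact N * (\<Prod>i = 0..<N. (1 / 2) ^ (i div (m - 1)) * S ^ (i mod (m - 1)))"
proof -
  have M0: "0 \<le> M" using f(3)[of 0] norm_ge_zero order_trans by blast
  have R1: "1 \<le> R" using M0 by (simp add: R)
  define F where "F = iter_poly f g n"
  have dF: "degree F = m" by (simp add: F_def degree_iter_poly m d_def e_def)
  have lF: "lead_coeff F = 1" unfolding F_def using f g by (intro monic_iter_poly) (auto simp: d_def e_def)
  define D where "D = pcompose F [:c, 1:] - F"
  define b where "b = of_nat m * c"
  have b: "b \<noteq> 0" using c(1) m(2) by (simp add: b_def)
  define H where "H = Polynomial.smult (inverse b) D"
  have cD: "coeff D k = of_nat (Suc k) * c * coeff F (Suc k)" if "m \<le> Suc k" for k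
    unfolding D_def by (rule coeff_shift_diff) (use that dF in simp)
  have cD1: "coeff D (m - 1) = b" using cD[of "m - 1"] m(2) lF dF by (simp add: b_def)
  have cH: "coeff H (m - 1) = 1" using cD1 b by (simp add: H_def)
  have dH: "degree H = m - 1"
  proof (rule antisym[OF degree_le le_degree])
    show "\<forall>i>m - 1. coeff H i = 0" using dF cD by (auto simp: H_def coeff_eq_0)
    show "coeff H (m - 1) \<noteq> 0" using cH by simp
  qed
  have Hmonic: "lead_coeff H = 1" using dH cH by simp
  have F_bound: "cmod (poly F y) \<le> R" if "preperiodic f (poly g y)" for y
    unfolding F_def poly_iter_poly R d_def
    by (rule preperiodic_bound[OF f(1) _ f(3) preperiodic_funpow[OF that]]) (use f(2) d_def in simp)
  have H_bound: "cmod (poly H (x j)) \<le> 1 / 2" if j: "j < N" for j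
  proof -
    have "poly D (x j) = poly F (x j + c) - poly F (x j)" by (simp add: D_def poly_pcompose add.commute)
    then have "cmod (poly D (x j)) \<le> cmod (poly F (x j + c)) + cmod (poly F (x j))"
      by (simp add: norm_triangle_ineq4)
    then have "cmod (poly D (x j)) \<le> 2 * R" using F_bound[OF pre(1)[OF j]] F_bound[OF pre(2)[OF j]] by linarith
    then have "cmod (poly H (x j)) \<le> cmod (inverse b) * (2 * R)"
      by (simp add: H_def norm_mult mult_left_mono)
    also have "cmod (inverse b) = cmod (inverse c) / of_nat m" 
      by (simp add: b_def norm_mult norm_inverse divide_inverse mult.commute)
    also have "\<dots> * (2 * R) \<le> M / of_nat m * (2 * R)" 
      using c(2) R1 by (intro mult_right_mono divide_right_mono) auto
    also have "\<dots> \<le> 1 / 2" using m(2,3) by (simp add: field_simps)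
    finally show ?thesis .
  qed
  have x_bound: "cmod (x j) \<le> S" if j: "j < N" for j
    unfolding S e_def
  proof (rule argument_bound[OF g(1) _ g(3)])
    show "1 \<le> degree g" using g(2) by (simp add: e_def)
    show "cmod (poly g (x j)) \<le> R" unfolding R d_def
      by (rule preperiodic_bound[OF f(1) _ f(3) pre(1)[OF j]]) (use f(2) d_def in simp)
  qed
  have "power_det N x = det (mat N N (\<lambda>(i, j). poly (digit_basis H i) (x j)))"
    by (rule power_det_digit_basis[OF Hmonic]) (use dH m(2) in simp)
  also have "cmod \<dots> \<le> fact N * (\<Prod>i = 0..<N. (1 / 2) ^ (i div (m - 1)) * S ^ (i mod (m - 1)))"
  proof (rule det_norm_bound)
    fix i j assume "i < N" "j < N"
    then show "cmod (poly (digit_basis H i) (x j)) \<le> (1 / 2) ^ (i div (m - 1)) * S ^ (i mod (m - 1))"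
      unfolding poly_digit_basis dH norm_mult norm_power
      using H_bound[of j] x_bound[of j] by (intro mult_mono power_mono) auto
  qed
  finally show ?thesis .
qed

text \<open>The logarithm of the product of the factors 1/2 is about \<open>- N\<^sup>2 ln 2 / (2 h)\<close>. The power of \<open>a\<close>, which
comes from the denominators, contributes at most about \<open>N\<^sup>2 ln a / m\<close>, which is smaller for large \<open>m\<close>. All other factors
have logarithm \<open>O(N ln N)\<close>.\<close>

lemma quadratic_decay_beats_growth:
  fixes a b :: real and h :: nat
  assumes a: "a \<ge> 1" and b: "b \<ge> 1" and h: "h \<ge> 1"
  shows "\<exists>k. \<forall>m\<ge>k. \<exists>N. a ^ (\<Sum>i = 0..<N. i div m + i mod m) *
    (fact N * (\<Prod>i = 0..<N. (1 / 2) ^ (i div h) * b ^ (i mod h))) < 1 / 2"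
proof -
  define k where "k = nat \<lceil>4 * h * ln a / ln 2\<rceil> + 1"
  have "\<exists>N. a ^ (\<Sum>i = 0..<N. i div m + i mod m) *
    (fact N * (\<Prod>i = 0..<N. (1 / 2) ^ (i div h) * b ^ (i mod h))) < 1 / 2" if m: "m \<ge> k" for m
  proof -
    have m1: "m \<ge> 1" and "4 * h * ln a / ln 2 \<le> m" using m unfolding k_def by linarith+
    then have am: "ln a / m \<le> ln 2 / (4 * h)" using h by (simp add: field_simps)
    \<comment> \<open>Half of the decay rate \<open>ln 2 / (2 h)\<close>; the choice of \<open>k\<close> leaves the other half for the powers of \<open>a\<close>.\<close>
    define \<kappa> where "\<kappa> = ln 2 / (4 * real h)"
    have \<kappa>: "\<kappa> > 0" using h by (simp add: \<kappa>_def)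
    define C where "C = ln a * m + 2 * \<kappa> + ln 2 + h * ln b"
    have "\<forall>\<^sub>F N :: nat in at_top. - \<kappa> * real N + ln (real N) + C \<le> -1"
      using \<kappa> by real_asymp
    then have "\<forall>\<^sub>F N :: nat in at_top. - \<kappa> * real N + ln (real N) + C \<le> -1 \<and> 2 \<le> N"
      by (intro eventually_conj eventually_ge_at_top)
    then obtain N :: nat where N: "- \<kappa> * real N + ln (real N) + C \<le> -1" "2 \<le> N"
      by (metis (mono_tags, lifting) eventually_sequentially order_refl)
    define W where "W = (\<Sum>i = 0..<N. i div m + i mod m)"
    define U where "U = (\<Sum>i = 0..<N. i div h)"
    have "real W \<le> (\<Sum>i = 0..<N. real N / m + m)"
      unfolding W_def of_nat_sum
    proof (rule sum_mono)
      fix i assume "i \<in> {0..<N}"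
      then have "real i / m \<le> real N / m" by (intro divide_right_mono) auto
      then have "real (i div m) \<le> real N / m" 
        using of_nat_div_le_of_nat[of i m, where ?'a = real] by linarith
      moreover have "real (i mod m) \<le> m" using m1 by (simp add: less_imp_le)
      ultimately show "real (i div m + i mod m) \<le> real N / m + m" by simp
    qed
    then have W: "real W \<le> N * (real N / m + m)" by simp
    have "(\<Sum>i = 0..<N. real i / h - 1) \<le> real U"
      unfolding U_def of_nat_sum
    proof (rule sum_mono)
      fix i
      have "i < h * (i div h) + h" using h mod_less_divisor[of h i] mult_div_mod_eq[of h i] by linarith
      then have "real i < real h * real (i div h) + real h" by (metis of_nat_add of_nat_less_iff of_nat_mult)
      then show "real i / h - 1 \<le> real (i div h)" using h by (simp add: field_simps)
    qed
    also have "(\<Sum>i = 0..<N. real i / h - 1) = (\<Sum>i = 0..<N. real i) / h - N"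
      by (simp add: sum_subtractf sum_divide_distrib)
    also have "(\<Sum>i = 0..<N. real i) = real N * (real N - 1) / 2"
      by (induction N) (auto simp: field_simps)
    finally have U: "real N * (real N - 1) / 2 / h - N \<le> real U" .
    have 1: "a ^ W \<le> exp (ln a * (N * (real N / m + m)))"
    proof -
      have "a ^ W = exp (real W * ln a)" using a by (simp add: exp_of_nat_mult)
      also have "\<dots> \<le> exp (ln a * (N * (real N / m + m)))" 
        unfolding exp_le_cancel_iff mult.commute[of "ln a"] using W a by (intro mult_right_mono) auto
      finally show ?thesis .
    qed
    have 2: "fact N \<le> exp (N * ln N)"
    proof -
      have "fact N \<le> real N ^ N" by (metis fact_le_power of_nat_power)
      also have "\<dots> = exp (N * ln N)" using N(2) by (simp add: exp_of_nat_mult)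
      finally show ?thesis .
    qed
    have 3: "(\<Prod>i = 0..<N. (1 / 2 :: real) ^ (i div h)) \<le> exp (- ln 2 * (real N * (real N - 1) / 2 / h - N))"
    proof -
      have "(\<Prod>i = 0..<N. (1 / 2 :: real) ^ (i div h)) = exp (- ln 2) ^ U"
        by (simp add: U_def exp_minus inverse_eq_divide flip: power_sum)
      also have "\<dots> = exp (- ln 2 * real U)" by (simp add: mult.commute flip: exp_of_nat_mult)
      also have "\<dots> \<le> exp (- ln 2 * (real N * (real N - 1) / 2 / h - N))" using U by simp
      finally show ?thesis .
    qed
    have 4: "(\<Prod>i = 0..<N. b ^ (i mod h)) \<le> exp (N * h * ln b)"
    proof -
      have "(\<Prod>i = 0..<N. b ^ (i mod h)) \<le> (\<Prod>i = 0..<N. b ^ h)"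
        using b h by (intro prod_mono conjI power_increasing) (auto simp: less_imp_le)
      also have "\<dots> = b ^ (N * h)" by (simp add: mult.commute flip: power_mult)
      also have "\<dots> = exp (real (N * h) * ln b)" unfolding exp_of_nat_mult using b by simp
      finally show ?thesis by simp
    qed
    have "a ^ W * (fact N * (\<Prod>i = 0..<N. (1 / 2) ^ (i div h) * b ^ (i mod h))) \<le>
      exp (ln a * (N * (real N / m + m))) * (exp (N * ln N) *
        (exp (- ln 2 * (real N * (real N - 1) / 2 / h - N)) * exp (N * h * ln b)))"
      unfolding prod.distrib using a b by (intro mult_mono 1 2 3 4 mult_nonneg_nonneg prod_nonneg) auto
    also have "\<dots> = exp (N * (N * (ln a / m) + ln a * m + ln N - 2 * \<kappa> * N + 2 * \<kappa> + ln 2 + h * ln b))"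
      unfolding exp_add[symmetric] \<kappa>_def using h by (simp add: field_simps)
    also have "\<dots> \<le> exp (N * (- \<kappa> * N + ln N + C))"
    proof -
      have "real N * (ln a / m) \<le> N * \<kappa>" using am by (intro mult_left_mono) (auto simp: \<kappa>_def)
      then show ?thesis unfolding C_def by (intro iffD2[OF exp_le_cancel_iff] mult_left_mono) (auto simp: algebra_simps)
    qed
    also have "\<dots> \<le> exp (- 2)"
    proof -
      have "real N * (- \<kappa> * N + ln N + C) \<le> real N * (-1)" using N(1) by (intro mult_left_mono) auto
      then show ?thesis using N(2) by simp
    qed
    also have "\<dots> < 1 / 2" using exp_ge_add_one_self[of "2::real"] by (simp add: exp_minus field_simps)
    finally show ?thesis unfolding W_def by blast
  qed
  then show ?thesis by blast
qed

section \<open>Finiteness of common preperiodic points\<close>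

lemma controlled_extend:
  assumes "controlled K F p M" "finite X" "X \<subseteq> icl K"
  shows "\<exists>L. controlled L F p M \<and> K \<subseteq> L \<and> X \<subseteq> L"
  using assms(2,3)
proof (induction X)
  case empty
  show ?case using assms(1) by blast
next
  case (insert a X)
  then obtain L where L: "controlled L F p M" "K \<subseteq> L" "X \<subseteq> L" by auto
  note R = subfield_subring[OF controlledD(1)[OF L(1)]]
  have "a \<in> icl L" using insert.prems icl_mono[OF L(2)] by blast
  then have "controlled (adj L a) F p M" by (rule controlled_adj_algebraic[OF L(1)])
  then show ?case using L subset_adj[OF R, of a] in_adj[OF R, of a] by blast
qed

lemma hom_funpow:
  assumes "is_subring L" "hom_on L \<sigma>" "f \<in> polys L" "y \<in> L"
  shows "(poly f ^^ n) y \<in> L \<and> \<sigma> ((poly f ^^ n) y) = (poly (map_poly \<sigma> f) ^^ n) (\<sigma> y)"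
proof (induction n)
  case (Suc n)
  then have n: "(poly f ^^ n) y \<in> L" 
    "\<sigma> ((poly f ^^ n) y) = (poly (map_poly \<sigma> f) ^^ n) (\<sigma> y)" by auto
  show ?case using poly_polys[OF assms(1,3) n(1)] poly_map_hom[OF assms(1-3) n(1)] n(2) by simp
qed (use assms(4) in simp)

lemma hom_preperiodic:
  assumes "is_subring L" "hom_on L \<sigma>" "f \<in> polys L" "y \<in> L" "preperiodic f y"
  shows "preperiodic (map_poly \<sigma> f) (\<sigma> y)"
proof -
  obtain i j where "i \<noteq> j" "(poly f ^^ i) y = (poly f ^^ j) y" using assms(5) by (auto simp: preperiodic_def)
  then show ?thesis unfolding preperiodic_def using hom_funpow[OF assms(1-4)] by metis
qed

text \<open>Two monic bases of the same Vandermonde determinant are played against each other: the basis made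
from \<open>f\<^sup>n\<^sup>' \<circ> g\<close> with \<open>n'\<close> large bounds its denominator, and the basis made from \<open>H\<close> with \<open>n\<close> fixed bounds all its
conjugates. The order of choices is \<open>K\<close>, \<open>p\<close>, \<open>M\<close>, then \<open>n\<close>, then \<open>n'\<close>, then \<open>N\<close>, and only then the points; it is
therefore important that adjoining the points does not change \<open>p\<close> and \<open>M\<close>.\<close>

lemma finite_common_preperiodic_monic:
  fixes f g :: "complex poly"
  assumes f: "degree f \<ge> 2" "lead_coeff f = 1" and g: "degree g \<ge> 1" "lead_coeff g = 1" and c: "c \<noteq> 0"
  shows "finite {z. preperiodic f (poly g z) \<and> preperiodic f (poly g (z + c))}" (is "finite ?S")
proof (rule ccontr)
  assume inf: "infinite ?S"
  \<comment> \<open>The inverse of \<open>c\<close> is included to keep the conjugates of \<open>c\<close> away from zero.\<close>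
  define F where "F = range (coeff f) \<union> range (coeff g) \<union> {c, inverse c}"
  have "finite F" unfolding F_def using finite_range_coeff by blast
  then obtain K where K: "controllable K" "F \<subseteq> K" using exists_controllable by blast
  then obtain p M0 where ctrl: "controlled K F p M0" using \<open>finite F\<close> by (auto simp: controllable_def)
  define M where "M = max M0 1"
  define d where "d = degree f"
  define e where "e = degree g"
  define R where "R = 1 + of_nat d * M"
  define S where "S = 1 + of_nat e * (M + R)"
  have pos: "1 \<le> M" "1 \<le> R" "1 \<le> S" by (auto simp: M_def R_def S_def)
  have large: "\<exists>n. k \<le> d ^ n * e" for k
  proof -
    have "k \<le> 2 ^ k" by (simp add: less_imp_le)
    also have "\<dots> \<le> d ^ k" using f(1) by (simp add: d_def power_mono)
    also have "\<dots> \<le> d ^ k * e" using g(1) by (simp add: e_def)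
    finally show ?thesis by blast
  qed
  obtain n where n: "nat \<lceil>4 * R * M\<rceil> + 2 \<le> d ^ n * e" using large by blast
  define m where "m = d ^ n * e"
  have m: "m \<ge> 2" "4 * R * M \<le> of_nat m" using n unfolding m_def by linarith+
  have "1 \<le> m - 1" using m(1) by linarith
  from quadratic_decay_beats_growth[OF pos(1,3) this]
  obtain k where k: "\<And>m'. m' \<ge> k \<Longrightarrow> \<exists>N. M ^ (\<Sum>i = 0..<N. i div m' + i mod m') *
    (fact N * (\<Prod>i = 0..<N. (1 / 2) ^ (i div (m - 1)) * S ^ (i mod (m - 1)))) < 1 / 2"
    by blast
  obtain n' where n': "k \<le> d ^ n' * e" using large by blast
  define m' where "m' = d ^ n' * e"
  define w where "w i = i div m' + i mod m'" for i
  obtain N where N: "M ^ (\<Sum>i = 0..<N. w i) *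
    (fact N * (\<Prod>i = 0..<N. (1 / 2) ^ (i div (m - 1)) * S ^ (i mod (m - 1)))) < 1 / 2"
    using k[of m'] n' unfolding m'_def w_def by blast
  obtain X where X: "finite X" "card X = N" "X \<subseteq> ?S" using infinite_arbitrarily_large[OF inf] by blast
  obtain x where x: "bij_betw x {0..<N} X" using ex_bij_betw_nat_finite[OF X(1)] X(2) by blast
  have pre: "preperiodic f (poly g (x j))" "preperiodic f (poly g (x j + c))" if "j < N" for j
    using X(3) bij_betwE[OF x] that by auto
  define B where "B = scaled_ring p F"
  have B: "is_subring B" "p \<in> B" unfolding B_def by (rule subring_scaled_ring, rule scaled_ring_p)
  note KD = controlledD[OF ctrl]
  note RK = subfield_subring[OF KD(1)]
  have BK: "B \<subseteq> K" unfolding B_def using KD by (intro scaled_ring_least RK) (auto intro: subring_mult RK)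
  have pf: "p * coeff f i \<in> B" and pg: "p * coeff g i \<in> B" for i
    unfolding B_def by (auto intro!: scaled_ring_F simp: F_def)
  have px: "p * x j \<in> icl B" if "j < N" for j
    by (rule preperiodic_integral[OF B KD(5) f pf g pg pre(1)[OF that]])
  have "X \<subseteq> icl K"
  proof
    fix y assume "y \<in> X"
    then obtain j where "j < N" "y = x j" using x by (auto simp: bij_betw_def)
    then have "p * y \<in> icl K" using px icl_mono[OF BK] by blast
    moreover have "p \<in> icl K" using KD(4) icl_base[OF RK] by blast
    ultimately have "p * y / p \<in> icl K" by (intro subfield_divide subfield_icl KD(1))
    then show "y \<in> icl K" using KD(5) by simp
  qed
  then obtain L where L: "controlled L F p M0" "K \<subseteq> L" "X \<subseteq> L" 
    using controlled_extend[OF ctrl X(1)] by blast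
  note LD = controlledD[OF L(1)]
  note RL = subfield_subring[OF LD(1)]
  have xL: "x j \<in> L" if "j < N" for j using L(3) bij_betwE[OF x] that by auto
  have FL: "F \<subseteq> L" by (rule LD(3))
  have fgL: "f \<in> polys L" "g \<in> polys L" "c \<in> L" "inverse c \<in> L" using FL by (auto simp: polys_def F_def)
  define W where "W = (\<Sum>i = 0..<N. w i)"
  \<comment> \<open>The exponent \<open>W\<close> clears the denominators of all rows in the basis made from \<open>f\<^sup>n\<^sup>' \<circ> g\<close>.\<close>
  define u where "u = p ^ W * power_det N x"
  have uL: "u \<in> L" unfolding u_def using power_det_hom(2)[of L "\<lambda>x. x" N x] xL RL LD(4)
    by (intro subring_mult subring_power RL) (auto simp: hom_on_def)
  have u0: "u \<noteq> 0" unfolding u_def using power_det_nonzero[of x N] x LD(5) by (simp add: bij_betw_def)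
  define P where "P = iter_poly f g n'"
  have dP: "degree P = m'" by (simp add: P_def degree_iter_poly m'_def d_def e_def)
  have m'1: "1 \<le> m'" using f g by (simp add: m'_def d_def e_def)
  have lP: "lead_coeff P = 1" unfolding P_def using f g by (intro monic_iter_poly) auto
  have "p ^ W * det (mat N N (\<lambda>(i, j). poly (digit_basis P i) (x j))) \<in> icl B"
    unfolding W_def
  proof (rule scaled_det_in_subring[OF subring_icl[OF B(1)]])
    fix i j assume "i < N" and j: "j < N"
    have "p ^ w i * poly (digit_basis P i) (x j) = (p * poly P (x j)) ^ (i div m') * (p * x j) ^ (i mod m')"
      by (simp add: w_def poly_digit_basis dP power_add power_mult_distrib)
    also have "\<dots> \<in> icl B" unfolding P_def
      by (intro subring_mult subring_power subring_icl B(1) px j 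
          preperiodic_integral_orbit[OF B KD(5) f pf pre(1)[OF j]])
    finally show "p ^ w i * poly (digit_basis P i) (x j) \<in> icl B" .
  qed
  then have "u \<in> icl B" unfolding u_def using power_det_digit_basis[OF lP, of N x] dP m'1 by simp
  then obtain \<sigma> where \<sigma>: "hom_on L \<sigma>" "1 / 2 < cmod (\<sigma> u)" "\<forall>y\<in>insert p F. cmod (\<sigma> y) \<le> M0"
    using LD(7)[OF uL _ u0, of "1 / 2"] unfolding B_def by auto
  have \<sigma>M: "cmod (\<sigma> y) \<le> M" if "y \<in> insert p F" for y using \<sigma>(3) that by (fastforce simp: M_def)
  have inv: "\<sigma> (inverse c) = inverse (\<sigma> c)" by (rule hom_inverse[OF LD(1) \<sigma>(1) fgL(3)])
  have det: "cmod (power_det N (\<lambda>j. \<sigma> (x j))) 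
    \<le> fact N * (\<Prod>i = 0..<N. (1 / 2) ^ (i div (m - 1)) * S ^ (i mod (m - 1)))"
  proof (rule power_det_small[where f = "map_poly \<sigma> f" and g = "map_poly \<sigma> g" and c = "\<sigma> c" and M = M and R = R and n = n])
    have df: "degree (map_poly \<sigma> f) = d" "degree (map_poly \<sigma> g) = e"
      unfolding d_def e_def using degree_map_hom[OF RL \<sigma>(1)] f(2) g(2) by auto
    show "lead_coeff (map_poly \<sigma> f) = 1" "lead_coeff (map_poly \<sigma> g) = 1"
      using lead_coeff_map_hom[OF RL \<sigma>(1)] f(2) g(2) by auto
    show "2 \<le> degree (map_poly \<sigma> f)" "1 \<le> degree (map_poly \<sigma> g)"
      unfolding df using f(1) g(1) by (auto simp: d_def e_def)
    show "cmod (coeff (map_poly \<sigma> f) i) \<le> M" "cmod (coeff (map_poly \<sigma> g) i) \<le> M" for i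
      unfolding coeff_hom[OF RL \<sigma>(1)] by (intro \<sigma>M; simp add: F_def)+
    show "\<sigma> c \<noteq> 0" using hom_eq_0[OF LD(1) \<sigma>(1) fgL(3)] c by simp
    show "cmod (inverse (\<sigma> c)) \<le> M" unfolding inv[symmetric] by (intro \<sigma>M) (simp add: F_def)
    show "preperiodic (map_poly \<sigma> f) (poly (map_poly \<sigma> g) (\<sigma> (x j)))" if j: "j < N" for j
      unfolding poly_map_hom[OF RL \<sigma>(1) fgL(2) xL[OF j]]
      by (intro hom_preperiodic[OF RL \<sigma>(1) fgL(1)] poly_polys RL fgL xL j pre)
    show "preperiodic (map_poly \<sigma> f) (poly (map_poly \<sigma> g) (\<sigma> (x j) + \<sigma> c))" if j: "j < N" for j
      unfolding hom_add[OF RL \<sigma>(1) xL[OF j] fgL(3), symmetric] 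
        poly_map_hom[OF RL \<sigma>(1) fgL(2) subring_add[OF RL xL[OF j] fgL(3)]]
      by (intro hom_preperiodic[OF RL \<sigma>(1) fgL(1)] poly_polys RL fgL subring_add xL j pre)
    show "m = degree (map_poly \<sigma> f) ^ n * degree (map_poly \<sigma> g)" unfolding df by (rule m_def)
    show "R = 1 + of_nat (degree (map_poly \<sigma> f)) * M" "S = 1 + of_nat (degree (map_poly \<sigma> g)) * (M + R)"
      unfolding df by (rule R_def, rule S_def)
  qed (rule m)+
  have "cmod (\<sigma> u) = cmod (\<sigma> p) ^ W * cmod (power_det N (\<lambda>j. \<sigma> (x j)))"
    unfolding u_def using hom_mult[OF RL \<sigma>(1) subring_power[OF RL LD(4)] power_det_hom(2)[OF RL \<sigma>(1) xL]]
      hom_power[OF RL \<sigma>(1) LD(4)] power_det_hom(1)[OF RL \<sigma>(1) xL]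
    by (simp add: norm_mult norm_power)
  also have "\<dots> \<le> M ^ W * (fact N * (\<Prod>i = 0..<N. (1 / 2) ^ (i div (m - 1)) * S ^ (i mod (m - 1))))"
    using \<sigma>M[of p] pos(1) det by (intro mult_mono power_mono) auto
  also have "\<dots> < 1 / 2" using N by (simp add: W_def)
  finally show False using \<sigma>(2) by simp
qed

lemma preperiodic_conjugate:
  assumes h: "\<And>y. poly f' (s * y) = s * poly f y" and "preperiodic f y"
  shows "preperiodic f' (s * y)"
proof -
  have "(poly f' ^^ n) (s * y) = s * (poly f ^^ n) y" for n
    by (induction n) (simp_all add: h)
  then show ?thesis using assms(2) unfolding preperiodic_def by metis
qed

theorem corollary1p9:
  fixes f g :: "complex poly" and c :: complex
  assumes "degree f \<ge> 2"
    and "degree g \<ge> 1"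
    and "c \<noteq> 0"
  shows "finite {z :: complex. preperiodic f (poly g z) \<and> preperiodic f (poly g (z + c))}"
proof -
  have nz: "lead_coeff f \<noteq> 0" "lead_coeff g \<noteq> 0" using assms by auto
  obtain s where s: "s ^ (degree f - 1) = lead_coeff f"
    using nth_root_exists[of "degree f - 1" "lead_coeff f"] assms(1) by auto
  have s0: "s \<noteq> 0" using s nz(1) assms(1) by (auto simp: power_0_left split: if_splits)
  obtain r where r: "r ^ degree g = s * lead_coeff g"
    using nth_root_exists[of "degree g" "s * lead_coeff g"] assms(2) by auto
  have r0: "r \<noteq> 0" using r nz(2) s0 assms(2) by (auto simp: power_0_left split: if_splits)
  \<comment> \<open>Conjugating \<open>f\<close> by the scaling with \<open>s\<close> and rescaling the parameter by \<open>r\<close> makes both polynomials monic.\<close>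
  define f' where "f' = Polynomial.smult s (pcompose f [:0, inverse s:])"
  define g' where "g' = Polynomial.smult s (pcompose g [:0, inverse r:])"
  have ev: "poly f' (s * y) = s * poly f y" "poly g' (r * y) = s * poly g y" for y
    using s0 r0 by (auto simp: f'_def g'_def poly_pcompose mult.commute[of _ "inverse _"] simp flip: mult.assoc)
  have deg: "degree f' = degree f" "degree g' = degree g" using s0 r0 by (auto simp: f'_def g'_def degree_pcompose)
  have "s ^ degree f = s * lead_coeff f" using s assms(1) by (metis Suc_diff_1 less_le_trans pos2 power_Suc)
  then have monic: "lead_coeff f' = 1" "lead_coeff g' = 1"
    unfolding deg unfolding f'_def g'_def using r s0 r0 nz
    by (auto simp: coeff_pcompose_linear power_inverse field_simps)
  define T where "T = {z. preperiodic f (poly g z) \<and> preperiodic f (poly g (z + c))}"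
  have "finite {z. preperiodic f' (poly g' z) \<and> preperiodic f' (poly g' (z + r * c))}"
    by (rule finite_common_preperiodic_monic) (use deg assms monic r0 in auto)
  moreover have "(*) r ` T \<subseteq> {z. preperiodic f' (poly g' z) \<and> preperiodic f' (poly g' (z + r * c))}"
  proof
    fix y assume "y \<in> (*) r ` T"
    then obtain z where z: "y = r * z" "preperiodic f (poly g z)" "preperiodic f (poly g (z + c))"
      by (auto simp: T_def)
    have "y + r * c = r * (z + c)" by (simp add: z(1) distrib_left)
    then show "y \<in> {z. preperiodic f' (poly g' z) \<and> preperiodic f' (poly g' (z + r * c))}"
      using preperiodic_conjugate[OF ev(1) z(2)] preperiodic_conjugate[OF ev(1) z(3)] by (simp add: z(1) ev(2))
  qed
  ultimately have "finite ((*) r ` T)" by (rule finite_subset[rotated])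
  then have "finite T" by (rule finite_imageD) (use r0 in \<open>auto simp: inj_on_def\<close>)
  then show ?thesis by (simp add: T_def)
qed

end
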